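(* Let $a,b,c,d,e,f>0$ with $a+b=\min\{a+b,\,c+d,\,e+f\}$, and let $\mathcal{F}_1,\mathcal{F}_2,\mathcal{F}_3$ be the free linkages in the plane with length vectors $(a,b)$, $(c,d)$, $(e,f)$ respectively. Suppose that $(\mathcal{F}_1,\mathcal{F}_2,\mathcal{F}_3)$ is generic and that $\pi$, but not $0$, is a possible angle for $\theta_1$, the image of $p$ being a non-degenerate closed interval $[\theta_{\min},\theta_{\max}]\subset(0,2\pi)$. Let $\mathbf{v}=(v_1,v_2,v_3,v_4)\in\{0,1\}^4$ be defined by: $v_1=1$ if $\mathcal{F}_2$ is collapsible and $v_1=0$ if $\mathcal{F}_2$ is not collapsible; $v_2=1$ if $\mathcal{F}_2$ is foldable at $\theta_{\min}$ and $\theta_{\max}$, and $v_2=0$ if $\mathcal{F}_2$ is not foldable at $\theta_{\min}$ or $\theta_{\max}$; $v_3=1$ if $\mathcal{F}_3$ is collapsible and $v_3=0$ if $\mathcal{F}_3$ is not collapsible; $v_4=1$ if $\mathcal{F}_3$ is foldable at $\theta_{\min}$ and $\theta_{\max}$, and $v_4=0$ if $\mathcal{F}_3$ is not foldable at $\theta_{\min}$ or $\theta_{\max}$. The pairs of $\mathbf{v}$ are $(v_1,v_2)$ and $(v_3,v_4)$. Then the moduli space $M(\mathcal{F}_1,\mathcal{F}_2,\mathcal{F}_3)$ of the multiquadrilateral linkage is formed by two circles if $\mathbf{v}$ has no $(1,1)$ pairs, or by two figure-8's if $\mathbf{v}$ has at least one $(1,1)$ pair. Furthermore: (1) the number of components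 of $M(\mathcal{F}_1,\mathcal{F}_2,\mathcal{F}_3)$ is $2^{k}$, where $k$ is the number of $(0,0)$ pairs in $\mathbf{v}$; (2) the number of points in $p^{-1}(\theta_{\min})$ and the number of points in $p^{-1}(\theta_{\max})$ are both equal to $2^{\,2-m}$, where $m=v_2+v_4$ is the number of 1's in even positions of $\mathbf{v}$; (3) the number of points in $p^{-1}(\pi)$ is $2^{\,2-n}$, where $n=v_1+v_3$ is the number of 1's in odd positions of $\mathbf{v}$.
   Context: A free linkage in $\mathbb{R}^2$ with length vector $(d_1,d_2)$ has configurations $(x_1,x_2,x_3)\in(\mathbb{R}^2)^3$ with $|x_1-x_2|=d_1$, $|x_2-x_3|=d_2$; $x_1$ is its initial and $x_3$ its terminal vertex. $C(\mathcal{F}_1,\mathcal{F}_2,\mathcal{F}_3)$ is the space of triples of configurations of $\mathcal{F}_1,\mathcal{F}_2,\mathcal{F}_3$ with all initial vertices at the origin and all terminal vertices coinciding, and $M(\mathcal{F}_1,\mathcal{F}_2,\mathcal{F}_3)=C(\mathcal{F}_1,\mathcal{F}_2,\mathcal{F}_3)/SO(2)$. For each $i$, $\theta_i\in[0,2\pi)$ (taken mod $2\pi$) is the clockwise angle, at the middle vertex of $\mathcal{F}_i$, from the first edge to the second edge of $\mathcal{F}_i$; thus $\theta_i=\pi$ means that the two edges are stretched out in a straight line and $\theta_i=0$ means that they are folded onto one another. The map $p:M(\mathcal{F}_1,\mathcal{F}_2,\mathcal{F}_3)\to S^1$ sends a configuration to its angle $\theta_1$. The linkage is called generic if $a=b$,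 $c=d$ and $e=f$ are not simultaneously true. $\mathcal{F}_i$ is called collapsible if there is at least one configuration of $(\mathcal{F}_1,\mathcal{F}_2,\mathcal{F}_3)$ in which $\mathcal{F}_i$ lies completely in a straight line with $\theta_i=\pi$. $\mathcal{F}_i$ is foldable at an angle $\theta$ if there is at least one configuration of $(\mathcal{F}_1,\mathcal{F}_2,\mathcal{F}_3)$ with $\theta_1=\theta$ in which $\mathcal{F}_i$ lies completely in a straight line with $\theta_i=0$. *)

theory Defs
  imports "HOL-Analysis.Analysis"
begin

text \<open>
  The plane is the type \<^typ>\<open>complex\<close>; under this identification \<open>SO(2)\<close> is the unit circle
  acting by multiplication. A free linkage is given by its length vector, a configuration of it by
  the triple of its vertices (initial, middle, terminal).
\<close>

type_synonym linkage = "real \<times> real"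
type_synonym config = "complex \<times> complex \<times> complex"

definition free_configs :: "linkage \<Rightarrow> config set" where
  "free_configs = (\<lambda>(d1, d2). {(x1, x2, x3). dist x1 x2 = d1 \<and> dist x2 x3 = d2})"

definition initial :: "config \<Rightarrow> complex" where
  "initial = (\<lambda>(x1, x2, x3). x1)"

definition terminal :: "config \<Rightarrow> complex" where
  "terminal = (\<lambda>(x1, x2, x3). x3)"

definition rotate_config :: "complex \<Rightarrow> config \<Rightarrow> config" where
  "rotate_config g = (\<lambda>(x1, x2, x3). (g * x1, g * x2, g * x3))"

text \<open>
  Seen from the middle vertex, the edges point along \<open>x1 - x2\<close> and \<open>x3 - x2\<close>. The clockwise angle
  from the first to the second is the \<open>\<theta> \<in> [0, 2\<pi>)\<close> for which \<open>x3 - x2\<close> is a positive multiple of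
  \<open>exp (- \<i> \<theta>) (x1 - x2)\<close>, that is, the argument of \<open>(x1 - x2) / (x3 - x2)\<close>.
\<close>

definition angle :: "config \<Rightarrow> real" where
  "angle = (\<lambda>(x1, x2, x3). Arg2pi ((x1 - x2) / (x3 - x2)))"

definition straight :: "config \<Rightarrow> bool" where
  "straight = (\<lambda>(x1, x2, x3). collinear {x1, x2, x3})"


type_synonym linkages = "linkage \<times> linkage \<times> linkage"
type_synonym configs = "config \<times> config \<times> config"

definition config_space :: "linkages \<Rightarrow> configs set" where
  "config_space = (\<lambda>(F1, F2, F3). {(c1, c2, c3).
     c1 \<in> free_configs F1 \<and> c2 \<in> free_configs F2 \<and> c3 \<in> free_configs F3 \<and>
     initial c1 = 0 \<and> initial c2 = 0 \<and> initial c3 = 0 \<and>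
     terminal c1 = terminal c2 \<and> terminal c2 = terminal c3})"

text \<open>The configuration of the \<open>i\<close>-th free linkage, for \<open>i \<in> {1, 2, 3}\<close>.\<close>

definition leg :: "nat \<Rightarrow> configs \<Rightarrow> config" where
  "leg i = (\<lambda>(c1, c2, c3). if i = 1 then c1 else if i = 2 then c2 else c3)"

definition rotate_configs :: "complex \<Rightarrow> configs \<Rightarrow> configs" where
  "rotate_configs g = (\<lambda>(c1, c2, c3). (rotate_config g c1, rotate_config g c2, rotate_config g c3))"

definition SO2_orbit :: "configs \<Rightarrow> configs set" where
  "SO2_orbit c = {rotate_configs g c | g. norm g = 1}"

definition quotient_topology :: "'a topology \<Rightarrow> ('a \<Rightarrow> 'b) \<Rightarrow> 'b topology" where
  "quotient_topology X q =
     topology (\<lambda>U. U \<subseteq> q ` topspace X \<and> openin X {x \<in> topspace X. q x \<in> U})"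

lemma openin_quotient_topology:
  "openin (quotient_topology X q) U \<longleftrightarrow>
     U \<subseteq> q ` topspace X \<and> openin X {x \<in> topspace X. q x \<in> U}"
proof -
  have "istopology (\<lambda>U. U \<subseteq> q ` topspace X \<and> openin X {x \<in> topspace X. q x \<in> U})"
    unfolding istopology_def
  proof (intro conjI allI impI)
    fix S T
    assume S: "S \<subseteq> q ` topspace X \<and> openin X {x \<in> topspace X. q x \<in> S}"
      and T: "T \<subseteq> q ` topspace X \<and> openin X {x \<in> topspace X. q x \<in> T}"
    then show "S \<inter> T \<subseteq> q ` topspace X" by blast
    have "{x \<in> topspace X. q x \<in> S \<inter> T} =
        {x \<in> topspace X. q x \<in> S} \<inter> {x \<in> topspace X. q x \<in> T}" by blast
    then show "openin X {x \<in> topspace X. q x \<in> S \<inter> T}"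
      using S T by (simp only: openin_Int)
  next
    fix \<K>
    assume K: "\<forall>K\<in>\<K>. K \<subseteq> q ` topspace X \<and> openin X {x \<in> topspace X. q x \<in> K}"
    then show "\<Union> \<K> \<subseteq> q ` topspace X" by blast
    have "{x \<in> topspace X. q x \<in> \<Union> \<K>} = (\<Union>K\<in>\<K>. {x \<in> topspace X. q x \<in> K})" by blast
    then show "openin X {x \<in> topspace X. q x \<in> \<Union> \<K>}"
      using K by (simp only:) (rule openin_Union, blast)
  qed
  then show ?thesis by (simp add: quotient_topology_def)
qed

lemma topspace_quotient_topology: "topspace (quotient_topology X q) = q ` topspace X"
proof (rule antisym)
  show "topspace (quotient_topology X q) \<subseteq> q ` topspace X"
    using openin_topspace[of "quotient_topology X q"] by (simp only: openin_quotient_topology)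
  have "{x \<in> topspace X. q x \<in> q ` topspace X} = topspace X" by blast
  then have "openin (quotient_topology X q) (q ` topspace X)"
    by (simp add: openin_quotient_topology)
  then show "q ` topspace X \<subseteq> topspace (quotient_topology X q)"
    by (rule openin_subset)
qed

lemma quotient_map_quotient_topology: "quotient_map X (quotient_topology X q) q"
  by (auto simp: quotient_map_def topspace_quotient_topology openin_quotient_topology)

definition moduli_space :: "linkages \<Rightarrow> configs set topology" where
  "moduli_space L = quotient_topology (top_of_set (config_space L)) SO2_orbit"

text \<open>The map \<open>p\<close>; it is well defined because angles are invariant under \<open>SO(2)\<close>.\<close>

definition theta1 :: "configs set \<Rightarrow> real" where
  "theta1 m = the_elem ((\<lambda>c. angle (leg 1 c)) ` m)"

lemma angle_rotate_config: "norm g = 1 \<Longrightarrow> angle (rotate_config g c) = angle c"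
proof (cases c)
  case (fields x1 x2 x3)
  assume "norm g = 1"
  then have "g \<noteq> 0" by auto
  then have "(g * x1 - g * x2) / (g * x3 - g * x2) = (x1 - x2) / (x3 - x2)"
    by (simp flip: right_diff_distrib)
  then show ?thesis by (simp add: fields angle_def rotate_config_def)
qed

lemma theta1_SO2_orbit: "theta1 (SO2_orbit c) = angle (leg 1 c)"
proof -
  have "leg 1 (rotate_configs g c) = rotate_config g (leg 1 c)" for g
    by (simp add: leg_def rotate_configs_def split: prod.split)
  then have "(\<lambda>c. angle (leg 1 c)) ` SO2_orbit c = (\<lambda>g. angle (leg 1 c)) ` {g::complex. norm g = 1}"
    by (auto simp: SO2_orbit_def setcompr_eq_image image_image angle_rotate_config cong: image_cong_simp)
  also have "\<dots> = {angle (leg 1 c)}"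
    using norm_one by blast
  finally show ?thesis by (simp add: theta1_def)
qed

definition generic :: "linkages \<Rightarrow> bool" where
  "generic = (\<lambda>((a, b), (c, d), (e, f)). \<not> (a = b \<and> c = d \<and> e = f))"

definition collapsible :: "linkages \<Rightarrow> nat \<Rightarrow> bool" where
  "collapsible L i \<longleftrightarrow> (\<exists>c \<in> config_space L. straight (leg i c) \<and> angle (leg i c) = pi)"

definition foldable_at :: "linkages \<Rightarrow> nat \<Rightarrow> real \<Rightarrow> bool" where
  "foldable_at L i \<theta> \<longleftrightarrow>
     (\<exists>c \<in> config_space L. angle (leg 1 c) = \<theta> \<and> straight (leg i c) \<and> angle (leg i c) = 0)"


definition circle :: "complex topology" where
  "circle = top_of_set (sphere 0 1)"

definition figure8 :: "complex topology" where
  "figure8 = top_of_set (sphere (- 1) 1 \<union> sphere 1 1)"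

text \<open>
  The two copies of \<open>Y\<close> need not be disjoint (how many components there are is a separate question),
  but they share only finitely many points; in particular they are different.
\<close>

definition formed_by_two :: "'a topology \<Rightarrow> 'b topology \<Rightarrow> bool" where
  "formed_by_two X Y \<longleftrightarrow> (\<exists>A B. A \<union> B = topspace X \<and> finite (A \<inter> B) \<and>
     subtopology X A homeomorphic_space Y \<and> subtopology X B homeomorphic_space Y)"

end

theory Submission
  imports Defs
begin

text \<open>
  Let \<open>r\<close> be the distance between the two common endpoints of the legs. By the law of cosines
  \<open>r\<^sup>2 = a\<^sup>2 + b\<^sup>2 - 2 a b cos \<theta>\<^sub>1\<close>, and \<open>r\<close> never vanishes because \<open>\<theta>\<^sub>1 = 0\<close> does not occur. Up to
  rotation the first leg is therefore determined by \<open>\<theta>\<^sub>1\<close>, while each other leg is a triangle over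
  the base of length \<open>r\<close>, determined by its signed area; the square of that area is prescribed by
  Heron's formula. So the moduli space is the space of all \<open>(\<theta>, y, z)\<close> with \<open>y\<^sup>2 = h \<theta>\<close> and
  \<open>z\<^sup>2 = k \<theta>\<close>, where \<open>h\<close> and \<open>k\<close> are the squared doubled areas of the second and the third leg
  (\<open>moduli_space_homeomorphic_model\<close>).

  The map \<open>\<theta> \<mapsto> r\<close> increases up to \<open>\<pi>\<close> and decreases symmetrically afterwards, and \<open>a + b\<close> is the
  smallest total length. Hence \<open>h\<close> can vanish only at \<open>\<pi>\<close>, which is collapsibility, and at the two
  ends, which is foldability there; the same holds for \<open>k\<close>, and one of the two does vanish at the
  ends, since otherwise the interval of possible angles could be extended (\<open>area_sq_zeros\<close>,
  \<open>symmetric_endpoints\<close>). The shape of the curve \<open>y\<^sup>2 = h \<theta>\<close> depends only on the zero set of \<open>h\<close>: with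
  zeros just at the ends it is a circle, and with a further zero in the middle it is a figure-8
  (\<open>double_curve_circle\<close>, \<open>double_curve_figure8\<close>).

  Suppose that \<open>h\<close> vanishes at the ends. The parts \<open>z \<ge> 0\<close> and \<open>z \<le> 0\<close> of the model are two copies of
  the curve \<open>y\<^sup>2 = h \<theta>\<close>, and they meet exactly over the zeros of \<open>k\<close>. This gives the two circles or
  figure-8's, and it gives two components if \<open>k\<close> has no zero and one component otherwise. If some
  pair is \<open>(1, 1)\<close>, its leg has to play the part of \<open>h\<close>; the two legs can be exchanged because the
  model is symmetric. A fibre of \<open>\<theta>\<^sub>1\<close> has one or two choices for each of \<open>y\<close> and \<open>z\<close>, according to
  whether \<open>h\<close> and \<open>k\<close> vanish there.
\<close>

section \<open>Double covers of an interval\<close>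

lemma homeomorphic_space_top_of_set:
  "top_of_set S homeomorphic_space top_of_set T \<longleftrightarrow> S homeomorphic T"
  unfolding homeomorphic_space_def homeomorphic_minimal homeomorphic_maps_def
  by (simp add: Pi_iff) blast

definition double_curve :: "(real \<Rightarrow> real) \<Rightarrow> real set \<Rightarrow> (real \<times> real) set" where
  "double_curve g I = {(t, y). t \<in> I \<and> y\<^sup>2 = g t}"

text \<open>
  The map that follows \<open>\<tau>\<close> on the base and keeps the sign of the second coordinate, moving each
  point to the point of the curve \<open>y\<^sup>2 = h t\<close> on the same side of the axis.
\<close>

definition carry :: "(real \<Rightarrow> real) \<Rightarrow> (real \<Rightarrow> real) \<Rightarrow> real \<times> real \<Rightarrow> real \<times> real" where
  "carry \<tau> h = (\<lambda>(t, y). (\<tau> t, sgn y * sqrt (h (\<tau> t))))"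

text \<open>
  On the half \<open>y \<ge> 0\<close> the map is \<open>(t, y) \<mapsto> (\<tau> t, \<surd>(h (\<tau> t)))\<close>, on the half \<open>y \<le> 0\<close> the root has the
  opposite sign, and both expressions are continuous. The two halves meet only where \<open>g\<close> vanishes, and there \<open>h \<circ> \<tau>\<close> vanishes as well,
  so that the two branches agree and can be pasted.
\<close>

lemma continuous_on_carry:
  assumes \<tau>: "continuous_on I \<tau>" "\<tau> ` I \<subseteq> J" and h: "continuous_on J h"
    and zero: "\<And>t. t \<in> I \<Longrightarrow> g t = 0 \<Longrightarrow> h (\<tau> t) = 0"
  shows "continuous_on (double_curve g I) (carry \<tau> h)"
proof -
  let ?C = "double_curve g I"
  let ?h = "\<lambda>p. sqrt (h (\<tau> (fst p)))"
  have \<tau>_fst: "continuous_on ?C (\<lambda>p. \<tau> (fst p))"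
    by (rule continuous_on_compose2[OF \<tau>(1)]) (auto intro!: continuous_intros simp: double_curve_def)
  have h_fst: "continuous_on ?C ?h"
    by (intro continuous_intros continuous_on_compose2[OF h \<tau>_fst])
       (use \<tau>(2) in \<open>auto simp: double_curve_def\<close>)
  have "continuous_on ?C (\<lambda>p. if 0 \<le> snd p then ?h p else - ?h p)"
  proof (rule continuous_on_cases_le[where h = snd and a = 0 and f = "\<lambda>p. - ?h p" and g = ?h, 
        THEN continuous_on_eq])
    show "continuous_on {p \<in> ?C. snd p \<le> 0} (\<lambda>p. - ?h p)"
      by (intro continuous_intros continuous_on_subset[OF h_fst]) auto
    show "continuous_on {p \<in> ?C. 0 \<le> snd p} ?h"
      by (intro continuous_on_subset[OF h_fst]) auto
  qed (use zero in \<open>auto intro!: continuous_intros simp: double_curve_def\<close>)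
  then have "continuous_on ?C (\<lambda>p. (\<tau> (fst p), if 0 \<le> snd p then ?h p else - ?h p))"
    by (intro continuous_intros \<tau>_fst)
  then show ?thesis
    by (rule continuous_on_eq) (use zero in \<open>auto simp: carry_def double_curve_def sgn_if\<close>)
qed

lemma carry_carry:
  assumes "\<sigma> (\<tau> t) = t" "y\<^sup>2 = g t" "0 \<le> h (\<tau> t)" "g t = 0 \<longleftrightarrow> h (\<tau> t) = 0"
  shows "carry \<sigma> g (carry \<tau> h (t, y)) = (t, y)"
proof (cases "y = 0")
  case False
  then have "h (\<tau> t) > 0" "sqrt (g t) = \<bar>y\<bar>"
    using assms by (auto simp: less_le real_sqrt_abs[symmetric] simp del: real_sqrt_abs)
  then show ?thesis
    using assms by (simp add: carry_def sgn_mult abs_sgn[symmetric] mult_sgn_abs)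
qed (use assms in \<open>auto simp: carry_def\<close>)

text \<open>
  Only the zero set matters: away from the zeros a curve \<open>y\<^sup>2 = g t\<close> consists of two branches, one on
  each side of the axis, and at the zeros they are glued. Carrying along \<open>\<tau>\<close> and along its
  inverse are mutually inverse maps.
\<close>

lemma double_curve_homeomorphic:
  assumes hom: "homeomorphism I J \<tau> \<sigma>"
    and g: "continuous_on I g" "\<And>t. t \<in> I \<Longrightarrow> 0 \<le> g t"
    and h: "continuous_on J h" "\<And>t. t \<in> J \<Longrightarrow> 0 \<le> h t"
    and zeros: "\<And>t. t \<in> I \<Longrightarrow> g t = 0 \<longleftrightarrow> h (\<tau> t) = 0"
  shows "double_curve g I homeomorphic double_curve h J"
proof (rule homeomorphicI[where f = "carry \<tau> h" and g = "carry \<sigma> g"])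
  have \<tau>: "continuous_on I \<tau>" "\<tau> ` I = J" and \<sigma>: "continuous_on J \<sigma>" "\<sigma> ` J = I"
    and inv: "\<And>t. t \<in> I \<Longrightarrow> \<sigma> (\<tau> t) = t" "\<And>s. s \<in> J \<Longrightarrow> \<tau> (\<sigma> s) = s"
    using hom by (auto simp: homeomorphism_def)
  have zeros': "h s = 0 \<longleftrightarrow> g (\<sigma> s) = 0" if "s \<in> J" for s
    using zeros[of "\<sigma> s"] that inv(2)[OF that] \<sigma>(2) by auto
  have sq: "(sgn y * sqrt u)\<^sup>2 = u" if "y\<^sup>2 = v" "0 \<le> u" "v = 0 \<longleftrightarrow> u = 0" for y u v :: real
    using that by (auto simp: power_mult_distrib sgn_if)
  have into: "carry \<tau> h ` double_curve g I \<subseteq> double_curve h J"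
    using \<tau>(2) zeros h(2) by (auto simp: carry_def double_curve_def intro: sq)
  have onto: "carry \<sigma> g ` double_curve h J \<subseteq> double_curve g I"
    using \<sigma>(2) zeros' g(2) by (auto simp: carry_def double_curve_def intro: sq)
  show id1: "carry \<sigma> g (carry \<tau> h p) = p" if "p \<in> double_curve g I" for p
    using that inv(1) \<tau>(2) h(2) zeros by (cases p) (auto simp: double_curve_def intro!: carry_carry)
  show id2: "carry \<tau> h (carry \<sigma> g p) = p" if "p \<in> double_curve h J" for p
    using that inv(2) \<sigma>(2) g(2) zeros' by (cases p) (auto simp: double_curve_def intro!: carry_carry)
  show "carry \<tau> h ` double_curve g I = double_curve h J"
    using into onto id2 by (metis (no_types, lifting) image_iff subsetI subset_antisym image_subset_iff)
  show "carry \<sigma> g ` double_curve h J = double_curve g I"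
    using into onto id1 by (metis (no_types, lifting) image_iff subsetI subset_antisym image_subset_iff)
  show "continuous_on (double_curve g I) (carry \<tau> h)"
    using \<tau> h zeros by (intro continuous_on_carry) auto
  show "continuous_on (double_curve h J) (carry \<sigma> g)"
    using \<sigma> g zeros' by (intro continuous_on_carry) auto
qed

lemma affine_homeomorphism:
  fixes \<alpha> \<beta> k :: real
  assumes "\<alpha> < \<beta>" "0 < k"
  shows "homeomorphism {\<alpha>..\<beta>} {- k..k}
    (\<lambda>t. 2 * k / (\<beta> - \<alpha>) * (t - (\<alpha> + \<beta>) / 2)) (\<lambda>s. (\<alpha> + \<beta>) / 2 + (\<beta> - \<alpha>) / (2 * k) * s)"
  (is "homeomorphism _ _ ?\<tau> ?\<sigma>")
proof (rule homeomorphismI)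
  show "continuous_on {\<alpha>..\<beta>} ?\<tau>" "continuous_on {- k..k} ?\<sigma>"
    by (intro continuous_intros)+
  show "?\<tau> ` {\<alpha>..\<beta>} \<subseteq> {- k..k}"
  proof (rule image_subsetI)
    fix t assume "t \<in> {\<alpha>..\<beta>}"
    then have "\<bar>(t - (\<alpha> + \<beta>) / 2) / ((\<beta> - \<alpha>) / 2)\<bar> \<le> 1"
      using assms by (simp add: abs_le_iff divide_simps)
    then have "\<bar>k * ((t - (\<alpha> + \<beta>) / 2) / ((\<beta> - \<alpha>) / 2))\<bar> \<le> k"
      unfolding abs_mult[of k] using assms by (simp add: mult_left_le del: abs_divide abs_mult)
    moreover have "?\<tau> t = k * ((t - (\<alpha> + \<beta>) / 2) / ((\<beta> - \<alpha>) / 2))"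
      using assms by (simp add: field_simps)
    ultimately have "\<bar>?\<tau> t\<bar> \<le> k" by metis
    moreover have "s \<in> {- k..k}" if "\<bar>s\<bar> \<le> k" for s using that by auto
    ultimately show "?\<tau> t \<in> {- k..k}" by blast
  qed
  show "?\<sigma> ` {- k..k} \<subseteq> {\<alpha>..\<beta>}"
  proof (rule image_subsetI)
    fix s assume "s \<in> {- k..k}"
    then have "\<bar>s / k\<bar> \<le> 1" using assms by (auto simp: divide_simps)
    then have "\<bar>(\<beta> - \<alpha>) / 2 * (s / k)\<bar> \<le> (\<beta> - \<alpha>) / 2"
      unfolding abs_mult[of "(\<beta> - \<alpha>) / 2"] using assms by (simp add: mult_left_le del: abs_divide)
    moreover have "?\<sigma> s = (\<alpha> + \<beta>) / 2 + (\<beta> - \<alpha>) / 2 * (s / k)" by simp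
    ultimately show "?\<sigma> s \<in> {\<alpha>..\<beta>}" unfolding atLeastAtMost_iff by argo
  qed
qed (use assms in \<open>auto simp: field_simps\<close>)

lemma double_curve_homeomorphic_complex:
  "double_curve g I homeomorphic (\<lambda>(x, y). Complex x y) ` double_curve g I"
  by (rule homeomorphicI[where f = "\<lambda>(x, y). Complex x y" and g = "\<lambda>z. (Re z, Im z)"])
     (auto intro!: continuous_intros simp: case_prod_unfold image_image Complex_eq)

text \<open>
  The unit circle is itself such a curve, namely \<open>y\<^sup>2 = 1 - s\<^sup>2\<close> over \<open>[-1, 1]\<close>, with zeros at the ends.
\<close>

lemma double_curve_circle:
  assumes "\<alpha> < \<beta>" "continuous_on {\<alpha>..\<beta>} g" "\<And>t. t \<in> {\<alpha>..\<beta>} \<Longrightarrow> 0 \<le> g t"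
    and zeros: "\<And>t. t \<in> {\<alpha>..\<beta>} \<Longrightarrow> g t = 0 \<longleftrightarrow> t = \<alpha> \<or> t = \<beta>"
  shows "top_of_set (double_curve g {\<alpha>..\<beta>}) homeomorphic_space circle"
proof -
  let ?h = "\<lambda>s::real. 1 - s\<^sup>2"
  have sq: "s\<^sup>2 \<le> 1 \<longleftrightarrow> -1 \<le> s \<and> s \<le> 1" for s :: real
    by (simp add: abs_square_le_1 abs_le_iff) linarith
  have "double_curve g {\<alpha>..\<beta>} homeomorphic double_curve ?h {- 1..1}"
  proof (rule double_curve_homeomorphic[OF affine_homeomorphism])
    fix t assume "t \<in> {\<alpha>..\<beta>}"
    have "?h (2 * 1 / (\<beta> - \<alpha>) * (t - (\<alpha> + \<beta>) / 2)) = 4 * (t - \<alpha>) * (\<beta> - t) / (\<beta> - \<alpha>)\<^sup>2"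
      using assms(1) by (simp add: divide_simps) (simp add: power2_eq_square algebra_simps)
    then show "g t = 0 \<longleftrightarrow> ?h (2 * 1 / (\<beta> - \<alpha>) * (t - (\<alpha> + \<beta>) / 2)) = 0"
      using assms(1) zeros[OF \<open>t \<in> _\<close>] by auto
  qed (use assms sq in \<open>auto intro!: continuous_intros\<close>)
  also have "double_curve ?h {- 1..1} homeomorphic (\<lambda>(x, y). Complex x y) ` double_curve ?h {- 1..1}"
    by (rule double_curve_homeomorphic_complex)
  also have "(\<lambda>(x, y). Complex x y) ` double_curve ?h {- 1..1} = sphere 0 1"
  proof -
    have "z \<in> sphere 0 1 \<longleftrightarrow> (Re z, Im z) \<in> double_curve ?h {- 1..1}" for z
    proof -
      have "z \<in> sphere 0 1 \<longleftrightarrow> (Re z)\<^sup>2 + (Im z)\<^sup>2 = 1" by (simp add: cmod_def)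
      also have "\<dots> \<longleftrightarrow> (Re z)\<^sup>2 \<le> 1 \<and> (Im z)\<^sup>2 = ?h (Re z)" using zero_le_power2[of "Im z"] by argo
      finally show ?thesis by (simp add: double_curve_def sq)
    qed
    then show ?thesis by (force simp: image_iff case_prod_unfold complex_eq_iff)
  qed
  finally show ?thesis by (simp add: circle_def homeomorphic_space_top_of_set)
qed

text \<open>
  The union of the unit circles about \<open>-1\<close> and \<open>1\<close> is the curve \<open>y\<^sup>2 = 1 - (\<bar>s\<bar> - 1)\<^sup>2\<close> over \<open>[-2, 2]\<close>,
  with zeros at \<open>-2\<close>, \<open>0\<close> and \<open>2\<close>; the affine map onto \<open>[-2, 2]\<close> takes the midpoint to \<open>0\<close>.
\<close>

lemma double_curve_figure8:
  assumes "\<alpha> < \<beta>" "continuous_on {\<alpha>..\<beta>} g" "\<And>t. t \<in> {\<alpha>..\<beta>} \<Longrightarrow> 0 \<le> g t"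
    and zeros: "\<And>t. t \<in> {\<alpha>..\<beta>} \<Longrightarrow> g t = 0 \<longleftrightarrow> t = \<alpha> \<or> t = (\<alpha> + \<beta>) / 2 \<or> t = \<beta>"
  shows "top_of_set (double_curve g {\<alpha>..\<beta>}) homeomorphic_space figure8"
proof -
  let ?h = "\<lambda>s::real. 1 - (\<bar>s\<bar> - 1)\<^sup>2"
  have h: "?h s = \<bar>s\<bar> * (2 - \<bar>s\<bar>)" for s :: real
    by (simp add: power2_eq_square algebra_simps)
  have "double_curve g {\<alpha>..\<beta>} homeomorphic double_curve ?h {- 2..2}"
  proof (rule double_curve_homeomorphic[OF affine_homeomorphism])
    fix t assume "t \<in> {\<alpha>..\<beta>}"
    define s where "s = 2 * 2 / (\<beta> - \<alpha>) * (t - (\<alpha> + \<beta>) / 2)"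
    have "s = 0 \<longleftrightarrow> t = (\<alpha> + \<beta>) / 2" "s = 2 \<longleftrightarrow> t = \<beta>" "s = - 2 \<longleftrightarrow> t = \<alpha>"
      using assms(1) by (auto simp: s_def field_simps)
    then show "g t = 0 \<longleftrightarrow> ?h (2 * 2 / (\<beta> - \<alpha>) * (t - (\<alpha> + \<beta>) / 2)) = 0"
      using zeros[OF \<open>t \<in> _\<close>] unfolding h s_def[symmetric] by auto
  next
    show "0 \<le> ?h t" if "t \<in> {- 2..2}" for t
      using that unfolding h by (auto intro!: mult_nonneg_nonneg)
  qed (use assms in \<open>auto intro!: continuous_intros\<close>)
  also have "double_curve ?h {- 2..2} homeomorphic (\<lambda>(x, y). Complex x y) ` double_curve ?h {- 2..2}"
    by (rule double_curve_homeomorphic_complex)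
  also have "(\<lambda>(x, y). Complex x y) ` double_curve ?h {- 2..2} = sphere (- 1) 1 \<union> sphere 1 1"
  proof -
    have "z \<in> sphere (- 1) 1 \<union> sphere 1 1 \<longleftrightarrow> (Re z, Im z) \<in> double_curve ?h {- 2..2}" for z
    proof -
      have L: "z \<in> sphere (- 1) 1 \<longleftrightarrow> (Re z + 1)\<^sup>2 + (Im z)\<^sup>2 = 1"
        by (simp add: dist_norm cmod_def power2_commute[of "- 1 - Re z"])
          (simp add: power2_eq_square algebra_simps)
      have R: "z \<in> sphere 1 1 \<longleftrightarrow> (Re z - 1)\<^sup>2 + (Im z)\<^sup>2 = 1"
        by (simp add: dist_norm cmod_def power2_commute[of 1 "Re z"])
      have bound: "\<bar>u\<bar> \<le> 1" if "u\<^sup>2 + v\<^sup>2 = 1" for u v :: real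
        using that zero_le_power2[of v] abs_square_le_1[of u] by linarith
      show ?thesis
      proof (cases "0 \<le> Re z")
        case True
        have "Re z = 0" if "z \<in> sphere (- 1) 1"
          using bound[of "Re z + 1" "Im z"] that True unfolding L by linarith
        then have "z \<in> sphere 1 1" if "z \<in> sphere (- 1) 1"
          using that unfolding L R by simp
        moreover have "Re z \<le> 2" if "z \<in> sphere 1 1"
          using bound[of "Re z - 1" "Im z"] that unfolding R by linarith
        moreover have "(Re z, Im z) \<in> double_curve ?h {- 2..2} \<longleftrightarrow> z \<in> sphere 1 1 \<and> Re z \<le> 2"
          unfolding R double_curve_def using True by simp argo
        ultimately show ?thesis by blast
      next
        case False
        have "z \<notin> sphere 1 1"
          using bound[of "Re z - 1" "Im z"] False unfolding R by linarith
        moreover have "- 2 \<le> Re z" if "z \<in> sphere (- 1) 1"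
          using bound[of "Re z + 1" "Im z"] that unfolding L by linarith
        moreover have "(\<bar>Re z\<bar> - 1)\<^sup>2 = (Re z + 1)\<^sup>2"
          using False by (simp add: power2_eq_square algebra_simps)
        then have "(Re z, Im z) \<in> double_curve ?h {- 2..2} \<longleftrightarrow> z \<in> sphere (- 1) 1 \<and> - 2 \<le> Re z"
          unfolding L double_curve_def using False by simp argo
        ultimately show ?thesis by blast
      qed
    qed
    then show ?thesis by (force simp: image_iff case_prod_unfold complex_eq_iff)
  qed
  finally show ?thesis by (simp add: figure8_def homeomorphic_space_top_of_set)
qed

section \<open>Two sheets over a double cover\<close>

lemma formed_by_two_homeomorphic:
  assumes "X' homeomorphic_space X" "formed_by_two X' Y"
  shows "formed_by_two X Y"
proof -
  obtain f where f: "homeomorphic_map X' X f"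
    using assms(1) by (auto simp: homeomorphic_space)
  obtain A B where AB: "A \<union> B = topspace X'" "finite (A \<inter> B)"
    "subtopology X' A homeomorphic_space Y" "subtopology X' B homeomorphic_space Y"
    using assms(2) by (auto simp: formed_by_two_def)
  have surj: "f ` topspace X' = topspace X" and inj: "inj_on f (topspace X')"
    using f by (simp_all add: homeomorphic_eq_everything_map)
  have sub: "subtopology X (f ` S) homeomorphic_space Y"
    if "S \<subseteq> topspace X'" "subtopology X' S homeomorphic_space Y" for S
  proof -
    have "homeomorphic_map (subtopology X' S) (subtopology X (f ` S)) f"
      by (rule homeomorphic_map_subtopologies[OF f]) (use that surj in auto)
    then show ?thesis
      using that(2) homeomorphic_map_imp_homeomorphic_space homeomorphic_space_sym homeomorphic_space_trans
      by blast
  qed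
  show ?thesis
    unfolding formed_by_two_def
  proof (intro exI conjI)
    show "f ` A \<union> f ` B = topspace X" using AB(1) surj by blast
    have "f ` A \<inter> f ` B = f ` (A \<inter> B)"
      using inj_on_image_Int[OF inj, of A B] AB(1) by blast
    then show "finite (f ` A \<inter> f ` B)" using AB(2) by simp
  qed (use sub AB in auto)
qed

lemma card_components_homeomorphic:
  assumes "X homeomorphic_space Y"
  shows "card (connected_components_of X) = card (connected_components_of Y)"
proof -
  obtain f where f: "homeomorphic_map X Y f"
    using assms by (auto simp: homeomorphic_space)
  have "inj_on ((`) f) (connected_components_of X)"
    by (rule inj_on_image)
       (use f in \<open>simp add: Union_connected_components_of homeomorphic_eq_everything_map\<close>)
  then show ?thesis
    by (simp add: homeomorphic_map_connected_components_of[OF f] card_image)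
qed

text \<open>
  If the pieces meet, their union is connected. If they are disjoint, each is also the complement
  of a closed set, so a connected set cannot meet both and the pieces are the components.
\<close>

lemma card_components_two_pieces:
  assumes X: "A \<union> B = topspace X" and cl: "closedin X A" "closedin X B"
    and conn: "connectedin X A" "connectedin X B" and ne: "A \<noteq> {}" "B \<noteq> {}"
  shows "card (connected_components_of X) = (if A \<inter> B = {} then 2 else 1)"
proof (cases "A \<inter> B = {}")
  case False
  then have "connectedin X (topspace X)"
    using connectedin_Un[OF conn] X by simp
  then have "connected_components_of X = {topspace X}"
    unfolding connected_components_of_eq_singleton using X ne by (auto simp: connectedin_topspace)
  then show ?thesis using False by simp
next
  case True
  have within: "C \<subseteq> A \<or> C \<subseteq> B" if "connectedin X C" for C
  proof -
    have "C \<subseteq> A \<union> B" using connectedin_subset_topspace[OF that] X by simp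
    moreover from this have "A \<inter> C = {} \<or> B \<inter> C = {}"
      using that cl True unfolding connectedin_closedin by blast
    ultimately show ?thesis by blast
  qed
  have comp: "S \<in> connected_components_of X" if "S \<in> {A, B}" for S
  proof -
    have S: "S \<noteq> {}" "connectedin X S" "S \<subseteq> topspace X" using that ne conn X by auto
    then have "X \<noteq> trivial_topology" by auto
    then obtain C where C: "C \<in> connected_components_of X" "S \<subseteq> C"
      using exists_connected_component_of_superset[OF S(2)] by blast
    then have "C \<subseteq> A \<or> C \<subseteq> B" using within connectedin_connected_components_of by blast
    then have "C = S" using C(2) S(1) that True by blast
    then show ?thesis using C(1) by simp
  qed
  have "C = A \<or> C = B" if C: "C \<in> connected_components_of X" for C
  proof -
    obtain S where S: "S \<in> {A, B}" "C \<subseteq> S"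
      using within[OF connectedin_connected_components_of[OF C]] by blast
    then have "\<not> disjnt C S"
      using nonempty_connected_components_of[OF C] by (auto simp: disjnt_def)
    then have "C = S"
      using pairwise_disjoint_connected_components_of[of X] C comp[OF S(1)] by (auto simp: pairwise_def)
    then show ?thesis using S(1) by blast
  qed
  with comp have "connected_components_of X = {A, B}" by blast
  moreover have "A \<noteq> B" using True ne by blast
  ultimately show ?thesis using True by simp
qed

lemma connected_space_top_of_set: "connected_space (top_of_set S) \<longleftrightarrow> connected S"
  by (simp flip: connectedin_iff_connected add: connectedin_def)

lemma connected_space_circle: "connected_space circle"
  by (simp add: circle_def connected_space_top_of_set connected_sphere)

lemma connected_space_figure8: "connected_space figure8"
proof -
  have "0 \<in> sphere (- 1) 1 \<inter> sphere (1::complex) 1" by simp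
  then have "sphere (- 1) 1 \<inter> sphere (1::complex) 1 \<noteq> {}" by blast
  then have "connected (sphere (- 1) 1 \<union> sphere (1::complex) 1)"
    by (intro connected_Un connected_sphere) auto
  then show ?thesis
    by (simp add: figure8_def connected_space_top_of_set)
qed

definition sheets :: "(real \<Rightarrow> real) \<Rightarrow> (real \<Rightarrow> real) \<Rightarrow> real set \<Rightarrow> (real \<times> real \<times> real) set" where
  "sheets h k I = {(t, y, z). t \<in> I \<and> y\<^sup>2 = h t \<and> z\<^sup>2 = k t}"

lemma sheets_swap: "top_of_set (sheets h k I) homeomorphic_space top_of_set (sheets k h I)"
  unfolding homeomorphic_space_top_of_set
  by (rule homeomorphicI[where f = "\<lambda>(t, y, z). (t, z, y)" and g = "\<lambda>(t, y, z). (t, z, y)"])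
     (auto intro!: continuous_intros simp: case_prod_unfold sheets_def image_iff)

text \<open>
  Used for \<open>s = 1\<close> and \<open>s = - 1\<close>, so that both signs of the last coordinate are treated at once.
\<close>

definition half :: "real \<Rightarrow> (real \<Rightarrow> real) \<Rightarrow> (real \<Rightarrow> real) \<Rightarrow> real set \<Rightarrow> (real \<times> real \<times> real) set" where
  "half s h k I = {p \<in> sheets h k I. 0 \<le> s * snd (snd p)}"

text \<open>
  On one half the last coordinate is recovered from the first one as \<open>z = s \<surd>(k t)\<close>.
\<close>

lemma half_homeomorphic:
  assumes k: "continuous_on I k" "\<And>t. t \<in> I \<Longrightarrow> 0 \<le> k t" and s: "\<bar>s\<bar> = 1"
  shows "half s h k I homeomorphic double_curve h I"
  unfolding homeomorphic_minimal
proof (intro exI conjI ballI)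
  let ?f = "\<lambda>p::real \<times> real \<times> real. (fst p, fst (snd p))"
  let ?g = "\<lambda>q::real \<times> real. (fst q, snd q, s * sqrt (k (fst q)))"
  have s': "s * s = 1" using s by (auto simp: abs_if split: if_splits)
  have z: "s * sqrt (k t) = z" if "z\<^sup>2 = k t" "0 \<le> s * z" for t z
  proof -
    have "sqrt (k t) = \<bar>s * z\<bar>"
      using s by (simp add: abs_mult flip: that(1))
    then have "s * sqrt (k t) = (s * s) * z" using that(2) by simp
    then show ?thesis using s' by simp
  qed
  fix p assume p: "p \<in> half s h k I"
  then show "?f p \<in> double_curve h I"
    by (auto simp: half_def sheets_def double_curve_def)
  show "?g (?f p) = p"
    using p by (cases p) (simp add: half_def sheets_def z)
next
  let ?f = "\<lambda>p::real \<times> real \<times> real. (fst p, fst (snd p))"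
  let ?g = "\<lambda>q::real \<times> real. (fst q, snd q, s * sqrt (k (fst q)))"
  fix q assume q: "q \<in> double_curve h I"
  have "s\<^sup>2 = 1" using s by (simp flip: abs_square_eq_1)
  moreover have "0 \<le> s * (s * sqrt (k (fst q)))"
  proof -
    have "s * (s * sqrt (k (fst q))) = s\<^sup>2 * sqrt (k (fst q))"
      by (simp add: power2_eq_square)
    also have "\<dots> \<ge> 0" using q k(2) by (auto simp: double_curve_def)
    finally show ?thesis .
  qed
  ultimately show "?g q \<in> half s h k I"
    using q k(2)[of "fst q"] by (cases q) (simp add: half_def sheets_def double_curve_def power_mult_distrib)
  show "?f (?g q) = q" by simp
next
  show "continuous_on (half s h k I) (\<lambda>p. (fst p, fst (snd p)))"
    by (intro continuous_intros)
  have "continuous_on (double_curve h I) (\<lambda>q. k (fst q))"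
    by (rule continuous_on_compose2[OF k(1)]) (auto intro!: continuous_intros simp: double_curve_def)
  then show "continuous_on (double_curve h I) (\<lambda>q. (fst q, snd q, s * sqrt (k (fst q))))"
    by (intro continuous_intros)
qed

lemma sheets_halves: "half 1 h k I \<union> half (- 1) h k I = sheets h k I"
  by (auto simp: half_def)

text \<open>
  The two halves meet in points with \<open>z = 0\<close>, that is, over zeros of \<open>k\<close>, and over each of those
  \<open>y\<close> takes at most two values.
\<close>

lemma formed_by_two_sheets:
  assumes k: "continuous_on I k" "\<And>t. t \<in> I \<Longrightarrow> 0 \<le> k t" and fin: "finite {t \<in> I. k t = 0}"
    and Y: "top_of_set (double_curve h I) homeomorphic_space Y"
  shows "formed_by_two (top_of_set (sheets h k I)) Y"
  unfolding formed_by_two_def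
proof (intro exI conjI)
  show "half 1 h k I \<union> half (- 1) h k I = topspace (top_of_set (sheets h k I))"
    by (simp add: sheets_halves)
  let ?Z = "{t \<in> I. k t = 0}"
  have "half 1 h k I \<inter> half (- 1) h k I \<subseteq> (\<Union>t\<in>?Z. {t} \<times> {sqrt (h t), - sqrt (h t)} \<times> {0})"
    by (auto simp: half_def sheets_def) (metis real_sqrt_abs abs_if minus_minus)+
  then show "finite (half 1 h k I \<inter> half (- 1) h k I)"
    by (rule finite_subset) (use fin in auto)
  have "subtopology (top_of_set (sheets h k I)) (half s h k I) homeomorphic_space Y" if "\<bar>s\<bar> = 1" for s
  proof -
    have "sheets h k I \<inter> half s h k I = half s h k I" by (auto simp: half_def)
    then show ?thesis
      using half_homeomorphic[OF k that, of h] Y homeomorphic_space_trans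
      by (simp add: subtopology_subtopology flip: homeomorphic_space_top_of_set) blast
  qed
  then show "subtopology (top_of_set (sheets h k I)) (half 1 h k I) homeomorphic_space Y"
    "subtopology (top_of_set (sheets h k I)) (half (- 1) h k I) homeomorphic_space Y" by simp_all
qed

lemma card_components_sheets:
  assumes k: "continuous_on I k" "\<And>t. t \<in> I \<Longrightarrow> 0 \<le> k t" and h: "\<And>t. t \<in> I \<Longrightarrow> 0 \<le> h t"
    and ne: "I \<noteq> {}" and conn: "connected (double_curve h I)"
  shows "card (connected_components_of (top_of_set (sheets h k I))) = (if \<exists>t\<in>I. k t = 0 then 1 else 2)"
proof -
  let ?X = "top_of_set (sheets h k I)"
  have closed: "closedin ?X (half s h k I)" for s
  proof -
    have "half s h k I = sheets h k I \<inter> {p. 0 \<le> s * snd (snd p)}" by (auto simp: half_def)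
    moreover have "closed {p::real \<times> real \<times> real. 0 \<le> s * snd (snd p)}"
      by (intro closed_Collect_le continuous_intros)
    ultimately show ?thesis by (metis closedin_closed_Int)
  qed
  have conn': "connectedin ?X (half s h k I)" if "\<bar>s\<bar> = 1" for s
    using homeomorphic_connectedness[OF half_homeomorphic[OF k that, of h]] conn
    by (auto simp: connectedin_subtopology half_def)
  obtain t where t: "t \<in> I" using ne by blast
  have ne': "half s h k I \<noteq> {}" if "\<bar>s\<bar> = 1" for s
  proof -
    have "(t, sqrt (h t)) \<in> double_curve h I" using t h by (simp add: double_curve_def)
    then show ?thesis
      using half_homeomorphic[OF k that, of h] by (metis empty_iff homeomorphic_empty(2))
  qed
  have meet: "half 1 h k I \<inter> half (- 1) h k I = {} \<longleftrightarrow> \<not> (\<exists>t\<in>I. k t = 0)"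
  proof -
    have "(t, sqrt (h t), 0) \<in> half 1 h k I \<inter> half (- 1) h k I" if "t \<in> I" "k t = 0" for t
      using that h by (simp add: half_def sheets_def)
    moreover have "k t = 0" "t \<in> I" if "(t, y, z) \<in> half 1 h k I \<inter> half (- 1) h k I" for t y z
      using that by (auto simp: half_def sheets_def)
    ultimately show ?thesis by fast
  qed
  show ?thesis
    by (subst card_components_two_pieces[of "half 1 h k I" "half (- 1) h k I"])
       (use closed conn' ne' meet in \<open>auto simp: sheets_halves\<close>)
qed

lemma card_square_roots:
  fixes u :: real
  assumes "0 \<le> u"
  shows "card {y. y\<^sup>2 = u} = (if u = 0 then 1 else 2)"
proof -
  have "{y. y\<^sup>2 = u} = {sqrt u, - sqrt u}"
  proof (intro subset_antisym subsetI)
    fix y assume "y \<in> {y. y\<^sup>2 = u}"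
    then have "sqrt u = \<bar>y\<bar>" by auto
    then show "y \<in> {sqrt u, - sqrt u}" by auto
  qed (use assms in auto)
  then show ?thesis using assms by simp
qed

lemma card_sheets_fibre:
  assumes "t \<in> I" "0 \<le> h t" "0 \<le> k t"
  shows "card {p \<in> sheets h k I. fst p = t} = (if h t = 0 then 1 else 2) * (if k t = 0 then 1 else 2)"
proof -
  have "{p \<in> sheets h k I. fst p = t} = {t} \<times> {y. y\<^sup>2 = h t} \<times> {z. z\<^sup>2 = k t}"
    using assms(1) by (auto simp: sheets_def)
  then show ?thesis using assms by (simp add: card_cartesian_product card_square_roots)
qed

text \<open>
  Here \<open>h\<close> is the function that vanishes at the ends: it decides the shape of each half, and \<open>k\<close>
  decides whether the halves meet.
\<close>

lemma sheets_circle_or_figure8: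
  assumes "\<alpha> < \<beta>" and h: "continuous_on {\<alpha>..\<beta>} h" "\<And>t. t \<in> {\<alpha>..\<beta>} \<Longrightarrow> 0 \<le> h t"
    and k: "continuous_on {\<alpha>..\<beta>} k" "\<And>t. t \<in> {\<alpha>..\<beta>} \<Longrightarrow> 0 \<le> k t"
    and h0: "\<And>t. t \<in> {\<alpha>..\<beta>} \<Longrightarrow> h t = 0 \<Longrightarrow> t \<in> {\<alpha>, (\<alpha> + \<beta>) / 2, \<beta>}" "h \<alpha> = 0" "h \<beta> = 0"
    and k0: "\<And>t. t \<in> {\<alpha>..\<beta>} \<Longrightarrow> k t = 0 \<Longrightarrow> t \<in> {\<alpha>, (\<alpha> + \<beta>) / 2, \<beta>}"
  shows "formed_by_two (top_of_set (sheets h k {\<alpha>..\<beta>})) (if h ((\<alpha> + \<beta>) / 2) = 0 then figure8 else circle)"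
    and "card (connected_components_of (top_of_set (sheets h k {\<alpha>..\<beta>}))) =
      (if k \<alpha> = 0 \<or> k ((\<alpha> + \<beta>) / 2) = 0 \<or> k \<beta> = 0 then 1 else 2)"
proof -
  let ?Y = "if h ((\<alpha> + \<beta>) / 2) = 0 then figure8 else circle"
  have Y: "top_of_set (double_curve h {\<alpha>..\<beta>}) homeomorphic_space ?Y"
  proof (cases "h ((\<alpha> + \<beta>) / 2) = 0")
    case True
    have "top_of_set (double_curve h {\<alpha>..\<beta>}) homeomorphic_space figure8"
      by (rule double_curve_figure8[OF \<open>\<alpha> < \<beta>\<close> h]) (use h0 True in blast)+
    then show ?thesis using True by simp
  next
    case False
    have "top_of_set (double_curve h {\<alpha>..\<beta>}) homeomorphic_space circle"
      by (rule double_curve_circle[OF \<open>\<alpha> < \<beta>\<close> h]) (use h0 False in blast)+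
    then show ?thesis using False by simp
  qed
  have "finite {t \<in> {\<alpha>..\<beta>}. k t = 0}"
    by (rule finite_subset[of _ "{\<alpha>, (\<alpha> + \<beta>) / 2, \<beta>}"]) (use k0 in blast, simp)
  then show "formed_by_two (top_of_set (sheets h k {\<alpha>..\<beta>})) ?Y"
    using formed_by_two_sheets[OF k _ Y] by blast
  have "connected (double_curve h {\<alpha>..\<beta>})"
    using homeomorphic_connected_space[OF Y] connected_space_circle connected_space_figure8
    by (auto simp: connected_space_top_of_set split: if_splits)
  then have "card (connected_components_of (top_of_set (sheets h k {\<alpha>..\<beta>}))) =
      (if \<exists>t\<in>{\<alpha>..\<beta>}. k t = 0 then 1 else 2)"
    by (intro card_components_sheets k h) (use \<open>\<alpha> < \<beta>\<close> in auto)
  moreover have "(\<exists>t\<in>{\<alpha>..\<beta>}. k t = 0) \<longleftrightarrow> k \<alpha> = 0 \<or> k ((\<alpha> + \<beta>) / 2) = 0 \<or> k \<beta> = 0"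
  proof -
    have "\<alpha> \<in> {\<alpha>..\<beta>}" "(\<alpha> + \<beta>) / 2 \<in> {\<alpha>..\<beta>}" "\<beta> \<in> {\<alpha>..\<beta>}" using \<open>\<alpha> < \<beta>\<close> by auto
    then show ?thesis using k0 by blast
  qed
  ultimately show "card (connected_components_of (top_of_set (sheets h k {\<alpha>..\<beta>}))) =
      (if k \<alpha> = 0 \<or> k ((\<alpha> + \<beta>) / 2) = 0 \<or> k \<beta> = 0 then 1 else 2)" by simp
qed

section \<open>The geometry of one leg\<close>

text \<open>
  The squared length of the third side of a triangle with sides \<open>p\<close> and \<open>q\<close> that enclose the
  angle \<open>\<theta>\<close>.
\<close>

definition base_sq :: "real \<Rightarrow> real \<Rightarrow> real \<Rightarrow> real" where
  "base_sq p q \<theta> = p\<^sup>2 + q\<^sup>2 - 2 * p * q * cos \<theta>"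

text \<open>
  The square of twice the area of a triangle with sides \<open>p\<close> and \<open>q\<close> over a base with squared
  length \<open>\<rho>\<close>. Taking the squared base length as the argument keeps everything polynomial; negative
  values occur exactly when there is no such triangle (for \<open>p, q, \<rho> > 0\<close>).
\<close>

definition area_sq :: "real \<Rightarrow> real \<Rightarrow> real \<Rightarrow> real" where
  "area_sq p q \<rho> = \<rho> * p\<^sup>2 - ((\<rho> + p\<^sup>2 - q\<^sup>2) / 2)\<^sup>2"

text \<open>
  Heron's formula. The factors show that the area vanishes exactly when the triangle is stretched or
  folded.
\<close>

lemma heron: "4 * area_sq p q \<rho> = ((p + q)\<^sup>2 - \<rho>) * (\<rho> - (p - q)\<^sup>2)"
  by (simp add: area_sq_def power2_eq_square field_simps)

lemma apex_quotient:
  assumes "(x1, x2, x3) \<in> free_configs (p, q)" "p > 0" "q > 0"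
  shows "x1 - x2 = complex_of_real (p / q) * cis (angle (x1, x2, x3)) * (x3 - x2)"
proof -
  have d: "cmod (x1 - x2) = p" "cmod (x3 - x2) = q"
    using assms(1) by (auto simp: free_configs_def dist_norm norm_minus_commute)
  let ?w = "(x1 - x2) / (x3 - x2)"
  \<comment> \<open>The quotient of the edges has modulus \<open>p / q\<close> and, by definition, the angle as its argument.\<close>
  have "?w = complex_of_real (cmod ?w) * cis (Arg2pi ?w)"
    using Arg2pi_eq[of ?w] by (simp add: cis_conv_exp)
  then have "?w = complex_of_real (p / q) * cis (angle (x1, x2, x3))"
    using d by (simp add: norm_divide angle_def)
  moreover have "x3 - x2 \<noteq> 0" using d(2) assms(3) by auto
  ultimately show ?thesis by (simp add: divide_eq_eq)
qed

lemma norm_one_minus_cis: "(cmod (complex_of_real q - complex_of_real p * cis \<theta>))\<^sup>2 = base_sq p q \<theta>"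
proof -
  have "(cmod (complex_of_real q - complex_of_real p * cis \<theta>))\<^sup>2 
      = (q - p * cos \<theta>)\<^sup>2 + (p * sin \<theta>)\<^sup>2"
    by (simp add: cmod_power2)
  also have "\<dots> = q\<^sup>2 + p\<^sup>2 * ((cos \<theta>)\<^sup>2 + (sin \<theta>)\<^sup>2) - 2 * p * q * cos \<theta>"
    by (simp only: power2_eq_square algebra_simps)
  finally show ?thesis by (simp add: base_sq_def)
qed

lemma law_of_cosines:
  assumes "(x1, x2, x3) \<in> free_configs (p, q)" "p > 0" "q > 0"
  shows "(cmod (x3 - x1))\<^sup>2 = base_sq p q (angle (x1, x2, x3))"
proof -
  let ?\<theta> = "angle (x1, x2, x3)"
  have q: "cmod (x3 - x2) = q"
    using assms(1) by (auto simp: free_configs_def dist_norm norm_minus_commute)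
  have "x3 - x1 = (x3 - x2) - (x1 - x2)" by simp
  also have "\<dots> = (x3 - x2) * (complex_of_real q - complex_of_real p * cis ?\<theta>) / complex_of_real q"
    unfolding apex_quotient[OF assms] using assms(3) by (simp add: field_simps)
  finally have "cmod (x3 - x1) = cmod (complex_of_real q - complex_of_real p * cis ?\<theta>)"
    using q assms(3) by (simp add: norm_mult norm_divide)
  then show ?thesis by (simp add: norm_one_minus_cis)
qed

lemma cos_unique_extrema:
  assumes "0 \<le> t" "t < 2 * pi"
  shows "cos t = 1 \<longleftrightarrow> t = 0" and "cos t = - 1 \<longleftrightarrow> t = pi"
proof -
  have "cos t \<noteq> cos 0" if "t \<noteq> 0" "t \<le> pi"
    using cos_monotone_0_pi[of 0 t] that assms by auto
  moreover have "cos t \<noteq> 1" if "t > pi"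
    using cos_monotone_0_pi[of 0 "2 * pi - t"] that assms by auto
  ultimately show "cos t = 1 \<longleftrightarrow> t = 0" by force
  have "cos t \<noteq> cos pi" if "t < pi"
    using cos_monotone_0_pi[of t pi] that assms by auto
  moreover have "cos t \<noteq> - 1" if "t > pi"
    using cos_monotone_0_pi[of "2 * pi - t" pi] that assms by auto
  ultimately show "cos t = - 1 \<longleftrightarrow> t = pi" by force
qed

text \<open>
  For the angles \<open>0\<close> and \<open>\<pi>\<close> the quotient of the two edges is real. The predicates for collapsing and
  folding are thus conditions on the angle alone, and \<open>folded_or_stretched\<close> turns them into
  conditions on the distance of the endpoints, which the legs have in common.
\<close>

lemma straight_if_angle:
  assumes "(x1, x2, x3) \<in> free_configs (p, q)" "p > 0" "q > 0"
    and "angle (x1, x2, x3) = 0 \<or> angle (x1, x2, x3) = pi"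
  shows "straight (x1, x2, x3)"
proof -
  define r where "r = p / q * cos (angle (x1, x2, x3))"
  have "cis (angle (x1, x2, x3)) = complex_of_real (cos (angle (x1, x2, x3)))"
    using assms(4) by (auto simp: complex_eq_iff)
  then have "x1 - x2 = r *\<^sub>R (x3 - x2)"
    using apex_quotient[OF assms(1-3)] by (simp add: r_def scaleR_conv_of_real)
  then have "collinear {0, x3 - x2, x1 - x2}" unfolding collinear_lemma by blast
  then have "collinear {x3, x2, x1}" by (simp add: collinear_3[of x3 x2 x1])
  then show ?thesis by (simp add: straight_def insert_commute)
qed

lemma folded_or_stretched:
  assumes "(x1, x2, x3) \<in> free_configs (p, q)" "p > 0" "q > 0"
  shows "straight (x1, x2, x3) \<and> angle (x1, x2, x3) = 0 \<longleftrightarrow> (cmod (x3 - x1))\<^sup>2 = (p - q)\<^sup>2"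
    and "straight (x1, x2, x3) \<and> angle (x1, x2, x3) = pi \<longleftrightarrow> (cmod (x3 - x1))\<^sup>2 = (p + q)\<^sup>2"
proof -
  let ?\<theta> = "angle (x1, x2, x3)"
  have \<theta>: "0 \<le> ?\<theta>" "?\<theta> < 2 * pi" by (simp_all add: angle_def Arg2pi_ge_0 Arg2pi_lt_2pi)
  have "base_sq p q ?\<theta> - (p - q)\<^sup>2 = 2 * (p * q) * (1 - cos ?\<theta>)"
    "base_sq p q ?\<theta> - (p + q)\<^sup>2 = - 2 * (p * q) * (1 + cos ?\<theta>)"
    by (simp_all add: base_sq_def power2_eq_square algebra_simps)
  moreover have "p * q \<noteq> 0" using assms by simp
  ultimately have "base_sq p q ?\<theta> = (p - q)\<^sup>2 \<longleftrightarrow> cos ?\<theta> = 1"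
    "base_sq p q ?\<theta> = (p + q)\<^sup>2 \<longleftrightarrow> cos ?\<theta> = - 1"
    by (smt (verit) mult_eq_0_iff)+
  then show "straight (x1, x2, x3) \<and> ?\<theta> = 0 \<longleftrightarrow> (cmod (x3 - x1))\<^sup>2 = (p - q)\<^sup>2"
    "straight (x1, x2, x3) \<and> ?\<theta> = pi \<longleftrightarrow> (cmod (x3 - x1))\<^sup>2 = (p + q)\<^sup>2"
    using straight_if_angle[OF assms] cos_unique_extrema[OF \<theta>] law_of_cosines[OF assms] by auto
qed

text \<open>
  The product \<open>cnj w * y\<close> collects the rotation invariants of a triangle \<open>0, y, w\<close>: its real part is
  the inner product, which is fixed by the side lengths, and its imaginary part is twice the signed
  area, in which only the sign is free.
\<close>

lemma triangle_coordinates: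
  assumes "cmod y = p" "cmod (y - w) = q"
  shows "Re (cnj w * y) = ((cmod w)\<^sup>2 + p\<^sup>2 - q\<^sup>2) / 2"
    and "(Im (cnj w * y))\<^sup>2 = area_sq p q ((cmod w)\<^sup>2)"
proof -
  have p: "p\<^sup>2 = (Re y)\<^sup>2 + (Im y)\<^sup>2" and q: "q\<^sup>2 = (Re y - Re w)\<^sup>2 + (Im y - Im w)\<^sup>2"
    using assms by (auto simp: cmod_power2)
  show re: "Re (cnj w * y) = ((cmod w)\<^sup>2 + p\<^sup>2 - q\<^sup>2) / 2"
    unfolding p q cmod_power2 by (simp add: power2_eq_square algebra_simps)
  have "(Im (cnj w * y))\<^sup>2 = (cmod (cnj w * y))\<^sup>2 - (Re (cnj w * y))\<^sup>2"
    by (simp add: cmod_power2)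
  then show "(Im (cnj w * y))\<^sup>2 = area_sq p q ((cmod w)\<^sup>2)"
    unfolding re area_sq_def norm_mult using assms by (simp add: power_mult_distrib)
qed

text \<open>
  The point \<open>y\<close> that solves \<open>cnj w * y = X + \<i> Y\<close>, with the real part \<open>X\<close> that the side lengths
  prescribe: the third vertex of the triangle over \<open>0, w\<close> with twice the signed area \<open>Y\<close>.
\<close>

definition apex :: "real \<Rightarrow> real \<Rightarrow> complex \<Rightarrow> real \<Rightarrow> complex" where
  "apex p q w Y = w * Complex (((cmod w)\<^sup>2 + p\<^sup>2 - q\<^sup>2) / 2) Y / complex_of_real ((cmod w)\<^sup>2)"

lemma cnj_apex: "w \<noteq> 0 \<Longrightarrow> cnj w * apex p q w Y = Complex (((cmod w)\<^sup>2 + p\<^sup>2 - q\<^sup>2) / 2) Y"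
  by (simp add: apex_def complex_norm_square[of w] del: of_real_power)

lemma apex_eqI:
  assumes "w \<noteq> 0" "cmod y = p" "cmod (y - w) = q"
  shows "y = apex p q w (Im (cnj w * y))"
proof -
  have "cnj w * y = cnj w * apex p q w (Im (cnj w * y))"
    unfolding cnj_apex[OF assms(1)] using triangle_coordinates(1)[OF assms(2,3)]
    by (simp add: complex_eq_iff)
  then show ?thesis using assms(1) by simp
qed

lemma apex_lengths:
  assumes "w \<noteq> 0" "Y\<^sup>2 = area_sq p q ((cmod w)\<^sup>2)" "p > 0" "q > 0"
  shows "cmod (apex p q w Y) = p" and "cmod (apex p q w Y - w) = q"
proof -
  let ?y = "apex p q w Y" and ?X = "((cmod w)\<^sup>2 + p\<^sup>2 - q\<^sup>2) / 2"
  have w: "(cmod w)\<^sup>2 > 0" using assms(1) by simp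
  have "(cmod w)\<^sup>2 * (cmod ?y)\<^sup>2 = (cmod (cnj w * ?y))\<^sup>2"
    by (simp add: norm_mult power_mult_distrib)
  also have "\<dots> = (cmod w)\<^sup>2 * p\<^sup>2"
    unfolding cnj_apex[OF assms(1)] by (simp add: cmod_power2[of "Complex _ _"] assms(2) area_sq_def)
  finally have yp: "(cmod ?y)\<^sup>2 = p\<^sup>2" using w by simp
  then show "cmod ?y = p" using assms(3) by (simp add: power2_eq_iff_nonneg)
  have "(cmod (?y - w))\<^sup>2 = (cmod ?y)\<^sup>2 + (cmod w)\<^sup>2 - 2 * Re (cnj w * ?y)"
    unfolding cmod_power2 by (simp add: power2_eq_square algebra_simps)
  also have "\<dots> = q\<^sup>2" unfolding cnj_apex[OF assms(1)] yp by (simp add: field_simps)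
  finally show "cmod (?y - w) = q" using assms(4) by (simp add: power2_eq_iff_nonneg)
qed

lemma apex_rotate: "cmod g = 1 \<Longrightarrow> apex p q (g * w) Y = g * apex p q w Y"
  by (simp add: apex_def norm_mult)

section \<open>The moduli space in coordinates\<close>

lemma topspace_moduli_space: "topspace (moduli_space L) = SO2_orbit ` config_space L"
  by (simp add: moduli_space_def topspace_quotient_topology)

lemma rotate_rotate: "rotate_configs g (rotate_configs g' u) = rotate_configs (g * g') u"
  by (simp add: rotate_configs_def rotate_config_def mult.assoc split: prod.split)

text \<open>
  One inclusion holds for every rotation; applying it to the inverse rotation gives the other.
\<close>

lemma SO2_orbit_rotate:
  assumes "cmod g = 1"
  shows "SO2_orbit (rotate_configs g u) = SO2_orbit u"
proof -
  have sub: "SO2_orbit (rotate_configs h v) \<subseteq> SO2_orbit v" if "cmod h = 1" for h v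
    using that unfolding SO2_orbit_def by (auto simp: rotate_rotate norm_mult)
  have "u = rotate_configs (inverse g) (rotate_configs g u)"
  proof -
    have "inverse g * g = 1" using assms by (intro left_inverse) auto
    then show ?thesis
      by (simp add: rotate_rotate) (simp add: rotate_configs_def rotate_config_def split: prod.split)
  qed
  then have "SO2_orbit u \<subseteq> SO2_orbit (rotate_configs g u)"
    using sub[of "inverse g" "rotate_configs g u"] assms by (simp add: norm_inverse)
  then show ?thesis using sub[OF assms] by blast
qed

lemma in_SO2_orbit: "u \<in> SO2_orbit u"
proof -
  have "u = rotate_configs 1 u" by (simp add: rotate_configs_def rotate_config_def split: prod.split)
  then show ?thesis unfolding SO2_orbit_def by (metis (mono_tags, lifting) mem_Collect_eq norm_one)
qed

lemma theta1_image_angles: "theta1 ` topspace (moduli_space L) = (\<lambda>u. angle (leg 1 u)) ` config_space L"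
  by (simp add: topspace_moduli_space image_image theta1_SO2_orbit)

text \<open>
  That the first leg is never folded keeps its angle inside the open interval from \<open>0\<close> to \<open>2\<pi>\<close>. This
  makes the angle a continuous function of the configuration, and it keeps the common terminal
  vertex away from the origin, so that all three legs have a non-degenerate base.
\<close>

locale three_legs =
  fixes a b c d e f :: real and L :: linkages
  assumes L: "L = ((a, b), (c, d), (e, f))"
    and pos: "a > 0" "b > 0" "c > 0" "d > 0" "e > 0" "f > 0"
    and never_folded: "\<And>x. x \<in> config_space L \<Longrightarrow> angle (leg 1 x) \<noteq> 0"
begin

definition height2_sq :: "real \<Rightarrow> real" where
  "height2_sq \<theta> = area_sq c d (base_sq a b \<theta>)"

definition height3_sq :: "real \<Rightarrow> real" where
  "height3_sq \<theta> = area_sq e f (base_sq a b \<theta>)"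

definition model :: "(real \<times> real \<times> real) set" where
  "model = sheets height2_sq height3_sq {0<..<2 * pi}"

definition coords :: "configs \<Rightarrow> real \<times> real \<times> real" where
  "coords = (\<lambda>((x1, x2, x3), (y1, y2, y3), (z1, z2, z3)).
     (angle (x1, x2, x3), Im (cnj y3 * y2), Im (cnj z3 * z2)))"

text \<open>
  A configuration with prescribed coordinates, normalized so that the second edge of the first leg
  points along the positive real axis. It is a continuous section of \<open>coords\<close>.
\<close>

definition realization :: "real \<times> real \<times> real \<Rightarrow> configs" where
  "realization = (\<lambda>(\<theta>, Y, Z).
     let w = complex_of_real b - complex_of_real a * cis \<theta>
     in ((0, - complex_of_real a * cis \<theta>, w), (0, apex c d w Y, w), (0, apex e f w Z, w)))"

lemma config_space_iff:
  "((x1, x, w), (y1, y, w'), (z1, z, w'')) \<in> config_space L \<longleftrightarrow>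
     x1 = 0 \<and> y1 = 0 \<and> z1 = 0 \<and> w' = w \<and> w'' = w \<and>
     cmod x = a \<and> cmod (x - w) = b \<and> cmod y = c \<and> cmod (y - w) = d \<and> cmod z = e \<and> cmod (z - w) = f"
  by (auto simp: L config_space_def free_configs_def initial_def terminal_def dist_norm)

lemma config_cases:
  assumes "u \<in> config_space L"
  obtains x y z w where "u = ((0, x, w), (0, y, w), (0, z, w))" "w \<noteq> 0"
    "cmod x = a" "cmod (x - w) = b" "cmod y = c" "cmod (y - w) = d" "cmod z = e" "cmod (z - w) = f"
    "(0, x, w) \<in> free_configs (a, b)" "(0, y, w) \<in> free_configs (c, d)" "(0, z, w) \<in> free_configs (e, f)"
    "0 < angle (0, x, w)" "angle (0, x, w) < 2 * pi"
proof -
  obtain x1 x w y1 y w' z1 z w'' where u: "u = ((x1, x, w), (y1, y, w'), (z1, z, w''))"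
    by (metis prod.exhaust)
  with assms have *: "x1 = 0" "y1 = 0" "z1 = 0" "w' = w" "w'' = w"
     "cmod x = a" "cmod (x - w) = b" "cmod y = c" "cmod (y - w) = d" "cmod z = e" "cmod (z - w) = f"
    by (auto simp: config_space_iff)
  have ne: "angle (0, x, w) \<noteq> 0"
    using never_folded[OF assms] by (simp add: u * leg_def)
  then have "0 < angle (0, x, w)" "angle (0, x, w) < 2 * pi"
    by (simp_all add: angle_def Arg2pi_lt_2pi order_le_neq_trans[OF Arg2pi_ge_0])
  moreover have "w \<noteq> 0"
    using ne by (cases "x = 0") (auto simp: angle_def Arg2pi_eq_0)
  ultimately show ?thesis
    by (intro that) (use * u in \<open>auto simp: free_configs_def dist_norm\<close>)
qed

text \<open>
  The squared base is \<open>(a - b)\<^sup>2 + 2 a b (1 - cos \<theta>)\<close>, so the endpoints of the first leg can coincide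
  only when it is folded onto itself.
\<close>

lemma base_sq_pos:
  assumes "0 < \<theta>" "\<theta> < 2 * pi"
  shows "base_sq a b \<theta> > 0"
proof -
  have "cos \<theta> < 1"
    using cos_unique_extrema(1)[of \<theta>] assms cos_le_one[of \<theta>] by linarith
  then have "0 < 2 * (a * b) * (1 - cos \<theta>)" using pos by simp
  also have "\<dots> \<le> (a - b)\<^sup>2 + 2 * (a * b) * (1 - cos \<theta>)" by simp
  also have "\<dots> = base_sq a b \<theta>" by (simp add: base_sq_def power2_eq_square algebra_simps)
  finally show ?thesis .
qed

lemma coords_in_model:
  assumes "u \<in> config_space L"
  shows "coords u \<in> model"
  using assms
proof (cases rule: config_cases)
  case (1 x y z w)
  have "(cmod w)\<^sup>2 = base_sq a b (angle (0, x, w))"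
    using law_of_cosines[OF 1(9)] pos by simp
  then show ?thesis
    using triangle_coordinates(2)[OF 1(5,6)] triangle_coordinates(2)[OF 1(7,8)] 1(12,13)
    by (simp add: 1(1) coords_def model_def sheets_def height2_sq_def height3_sq_def)
qed

lemma realization_in_config_space:
  assumes "p \<in> model"
  shows "realization p \<in> config_space L" and "coords (realization p) = p"
proof -
  obtain \<theta> Y Z where p: "p = (\<theta>, Y, Z)" by (metis prod.exhaust)
  define w where "w = complex_of_real b - complex_of_real a * cis \<theta>"
  have \<theta>: "0 < \<theta>" "\<theta> < 2 * pi" using assms by (auto simp: p model_def sheets_def)
  have w2: "(cmod w)\<^sup>2 = base_sq a b \<theta>" by (simp add: w_def norm_one_minus_cis)
  then have w: "w \<noteq> 0" using base_sq_pos[OF \<theta>] by auto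
  have Y: "Y\<^sup>2 = area_sq c d ((cmod w)\<^sup>2)" and Z: "Z\<^sup>2 = area_sq e f ((cmod w)\<^sup>2)"
    using assms by (auto simp: p model_def sheets_def w2 height2_sq_def height3_sq_def)
  have eq: "realization p = ((0, - complex_of_real a * cis \<theta>, w), (0, apex c d w Y, w), (0, apex e f w Z, w))"
    by (simp add: p realization_def Let_def w_def)
  show "realization p \<in> config_space L"
    unfolding eq config_space_iff using pos apex_lengths[OF w Y] apex_lengths[OF w Z]
    by (simp add: norm_mult w_def)
  have "angle (0, - complex_of_real a * cis \<theta>, w) = Arg2pi (complex_of_real a * cis \<theta> / complex_of_real b)"
    by (simp add: angle_def w_def)
  also have "\<dots> = \<theta>"
    by (rule Arg2pi_unique[of "a / b"]) (use pos \<theta> in \<open>auto simp: cis_conv_exp\<close>)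
  finally show "coords (realization p) = p"
    unfolding eq coords_def prod.case cnj_apex[OF w] by (simp add: p)
qed

lemma coords_rotate:
  assumes "cmod g = 1"
  shows "coords (rotate_configs g u) = coords u"
proof -
  obtain x1 x w y1 y w' z1 z w'' where u: "u = ((x1, x, w), (y1, y, w'), (z1, z, w''))"
    by (metis prod.exhaust)
  have "cnj g * g = 1" using complex_norm_square[of g] assms by (simp add: mult.commute)
  then have "cnj (g * s) * (g * t) = cnj s * t" for s t
  proof -
    have "cnj (g * s) * (g * t) = (cnj g * g) * (cnj s * t)" by (simp add: mult_ac)
    then show ?thesis using \<open>cnj g * g = 1\<close> by simp
  qed
  then show ?thesis
    using angle_rotate_config[OF assms, of "(x1, x, w)"]
    by (simp only: u coords_def rotate_configs_def rotate_config_def prod.case)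
qed

text \<open>
  Rotating the second edge of the first leg into the positive real axis brings a configuration
  into the normalized position: the angle then determines the first leg, and the signed areas determine
  the apexes of the two others.
\<close>

lemma rotate_to_realization:
  assumes "u \<in> config_space L"
  shows "\<exists>g. cmod g = 1 \<and> u = rotate_configs g (realization (coords u))"
  using assms
proof (cases rule: config_cases)
  case (1 x y z w)
  let ?\<theta> = "angle (0, x, w)"
  define g where "g = (w - x) / complex_of_real b"
  define v where "v = complex_of_real b - complex_of_real a * cis ?\<theta>"
  have g: "cmod g = 1"
    using 1(4) pos by (simp add: g_def norm_divide norm_minus_commute)
  have gb: "w - x = g * complex_of_real b" using pos by (simp add: g_def)
  have "- x = complex_of_real (a / b) * cis ?\<theta> * (w - x)"
    using apex_quotient[OF 1(9)] pos by simp
  also have "\<dots> = g * (complex_of_real a * cis ?\<theta>)"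
    unfolding gb using pos by simp
  finally have x: "x = g * (- complex_of_real a * cis ?\<theta>)"
    by (metis minus_minus mult_minus_left mult_minus_right)
  have "w = g * complex_of_real b + x" using gb by (simp add: algebra_simps)
  also have "\<dots> = g * v" by (subst x) (simp add: v_def right_diff_distrib)
  finally have w: "w = g * v" .
  have "y = g * apex c d v (Im (cnj w * y))" "z = g * apex e f v (Im (cnj w * z))"
    using apex_eqI[OF 1(2,5,6)] apex_eqI[OF 1(2,7,8)] apex_rotate[OF g, of _ _ v] w by metis+
  then have "rotate_configs g ((0, - complex_of_real a * cis ?\<theta>, v),
      (0, apex c d v (Im (cnj w * y)), v), (0, apex e f v (Im (cnj w * z)), v)) = u"
    using x w by (simp only: 1(1) rotate_configs_def rotate_config_def prod.case mult_zero_right)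
  moreover have "realization (coords u) = ((0, - complex_of_real a * cis ?\<theta>, v),
      (0, apex c d v (Im (cnj w * y)), v), (0, apex e f v (Im (cnj w * z)), v))"
    by (simp add: 1(1) coords_def realization_def Let_def v_def)
  ultimately have "u = rotate_configs g (realization (coords u))" by simp
  then show ?thesis using g by blast
qed

lemma SO2_orbit_eq_iff:
  assumes "u \<in> config_space L" "u' \<in> config_space L"
  shows "SO2_orbit u = SO2_orbit u' \<longleftrightarrow> coords u = coords u'"
proof
  assume "SO2_orbit u = SO2_orbit u'"
  then obtain g where "cmod g = 1" "u = rotate_configs g u'"
    using in_SO2_orbit[of u] unfolding SO2_orbit_def by auto
  then show "coords u = coords u'" using coords_rotate by simp
next
  assume "coords u = coords u'"
  then show "SO2_orbit u = SO2_orbit u'"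
    using rotate_to_realization[OF assms(1)] rotate_to_realization[OF assms(2)] SO2_orbit_rotate by metis
qed

lemma continuous_on_coords: "continuous_on (config_space L) coords"
proof -
  let ?x = "\<lambda>u::configs. fst (snd (fst u))" and ?w = "\<lambda>u::configs. snd (snd (fst u))"
  have "continuous_on (config_space L) (\<lambda>u. Arg2pi (- ?x u / (?w u - ?x u)))"
  proof (rule continuous_on_compose2[where g = Arg2pi])
    show "continuous_on (- \<real>\<^sub>\<ge>\<^sub>0) Arg2pi"
      by (intro continuous_at_imp_continuous_on ballI continuous_at_Arg2pi) auto
    show "(\<lambda>u. - ?x u / (?w u - ?x u)) ` config_space L \<subseteq> - \<real>\<^sub>\<ge>\<^sub>0"
    proof safe
      fix u assume u: "u \<in> config_space L" and nonneg: "- ?x u / (?w u - ?x u) \<in> \<real>\<^sub>\<ge>\<^sub>0"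
      from u show False
      proof (cases rule: config_cases)
        case (1 x y z w)
        have "Arg2pi (- x / (w - x)) = 0"
          using nonneg by (simp only: 1(1) fst_conv snd_conv Arg2pi_eq_0 complex_nonneg_Reals_iff
            complex_is_Real_iff)
        then show False using 1(12) by (simp add: angle_def)
      qed
    qed
    have "?w u - ?x u \<noteq> 0" if "u \<in> config_space L" for u
      using that pos by (elim config_cases) auto
    then show "continuous_on (config_space L) (\<lambda>u. - ?x u / (?w u - ?x u))"
      by (intro continuous_intros) auto
  qed
  then have "continuous_on (config_space L) (\<lambda>u. (Arg2pi (- ?x u / (?w u - ?x u)),
      Im (cnj (snd (snd (fst (snd u)))) * fst (snd (fst (snd u)))),
      Im (cnj (snd (snd (snd (snd u)))) * fst (snd (snd (snd u))))))"
    by (intro continuous_intros)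
  then show ?thesis
    by (rule continuous_on_eq) (elim config_cases, simp add: coords_def angle_def)
qed

lemma continuous_on_realization: "continuous_on model realization"
proof -
  let ?w = "\<lambda>p::real \<times> real \<times> real. complex_of_real b - complex_of_real a * cis (fst p)"
  have ne: "?w p \<noteq> 0" if "p \<in> model" for p
  proof -
    have "base_sq a b (fst p) > 0"
      using that base_sq_pos by (auto simp: model_def sheets_def)
    then show ?thesis using norm_one_minus_cis[of b a "fst p"] by auto
  qed
  have apex: "continuous_on model (\<lambda>p. apex q r (?w p) (h p))" if "continuous_on model h" for q r h
    unfolding apex_def Complex_eq by (intro continuous_intros that) (use ne in auto)
  show ?thesis
    unfolding realization_def case_prod_unfold Let_def by (intro continuous_intros apex)
qed

text \<open>
  The coordinates are constant on orbits, so any representative may be chosen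
  (\<open>moduli_coords_orbit\<close>).
\<close>

definition moduli_coords :: "configs set \<Rightarrow> real \<times> real \<times> real" where
  "moduli_coords m = coords (SOME u. u \<in> config_space L \<and> m = SO2_orbit u)"

lemma moduli_coords_orbit:
  assumes "u \<in> config_space L"
  shows "moduli_coords (SO2_orbit u) = coords u"
proof -
  let ?v = "SOME v. v \<in> config_space L \<and> SO2_orbit u = SO2_orbit v"
  have "?v \<in> config_space L \<and> SO2_orbit u = SO2_orbit ?v"
    by (rule someI[of _ u]) (use assms in simp)
  then show ?thesis
    unfolding moduli_coords_def using SO2_orbit_eq_iff[OF assms, of ?v] by simp
qed

text \<open>
  The coordinates descend to the quotient and separate orbits; the continuous section
  \<open>realization\<close> provides a continuous inverse.
\<close>

lemma moduli_space_homeomorphic_model: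
  "homeomorphic_maps (moduli_space L) (top_of_set model) moduli_coords (SO2_orbit \<circ> realization)"
  unfolding homeomorphic_maps_def
proof (intro conjI ballI)
  have q: "quotient_map (top_of_set (config_space L)) (moduli_space L) SO2_orbit"
    unfolding moduli_space_def by (rule quotient_map_quotient_topology)
  have "continuous_map (top_of_set (config_space L)) (top_of_set model) coords"
    using continuous_on_coords coords_in_model by auto
  then have "continuous_map (top_of_set (config_space L)) (top_of_set model) (moduli_coords \<circ> SO2_orbit)"
    by (rule continuous_map_eq) (simp add: moduli_coords_orbit)
  then show "continuous_map (moduli_space L) (top_of_set model) moduli_coords"
    using continuous_compose_quotient_map_eq[OF q] by blast
  have "continuous_map (top_of_set model) (top_of_set (config_space L)) realization"
    using continuous_on_realization realization_in_config_space(1) by auto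
  then show "continuous_map (top_of_set model) (moduli_space L) (SO2_orbit \<circ> realization)"
    using quotient_imp_continuous_map[OF q] continuous_map_compose by blast
next
  fix m assume "m \<in> topspace (moduli_space L)"
  then obtain u where u: "u \<in> config_space L" "m = SO2_orbit u" by (auto simp: topspace_moduli_space)
  have "SO2_orbit (realization (coords u)) = SO2_orbit u"
    using rotate_to_realization[OF u(1)] SO2_orbit_rotate by metis
  then show "(SO2_orbit \<circ> realization) (moduli_coords m) = m"
    using u moduli_coords_orbit by simp
next
  fix p assume "p \<in> topspace (top_of_set model)"
  then show "moduli_coords ((SO2_orbit \<circ> realization) p) = p"
    using realization_in_config_space moduli_coords_orbit by simp
qed

lemma bij_betw_moduli_coords: "bij_betw moduli_coords (topspace (moduli_space L)) model"
proof -
  have "homeomorphic_map (moduli_space L) (top_of_set model) moduli_coords"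
    using moduli_space_homeomorphic_model homeomorphic_map_maps by blast
  then show ?thesis
    unfolding bij_betw_def homeomorphic_eq_everything_map by simp
qed

lemma fst_coords: "fst (coords u) = angle (leg 1 u)"
proof -
  obtain x y w v where "u = ((x, y, w), v)" by (metis prod.exhaust)
  then show ?thesis by (cases v) (auto simp: coords_def leg_def)
qed

lemma theta1_moduli_coords:
  assumes "m \<in> topspace (moduli_space L)"
  shows "theta1 m = fst (moduli_coords m)"
proof -
  obtain u where u: "u \<in> config_space L" "m = SO2_orbit u"
    using assms by (auto simp: topspace_moduli_space)
  then show ?thesis by (simp add: theta1_SO2_orbit moduli_coords_orbit fst_coords)
qed

lemma theta1_image:
  "theta1 ` topspace (moduli_space L) = {\<theta> \<in> {0<..<2 * pi}. 0 \<le> height2_sq \<theta> \<and> 0 \<le> height3_sq \<theta>}"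
proof -
  have "theta1 ` topspace (moduli_space L) = (\<lambda>m. fst (moduli_coords m)) ` topspace (moduli_space L)"
    by (intro image_cong refl theta1_moduli_coords)
  also have "\<dots> = fst ` model"
    using bij_betw_imp_surj_on[OF bij_betw_moduli_coords] by (simp flip: image_image)
  also have "\<dots> = {\<theta> \<in> {0<..<2 * pi}. 0 \<le> height2_sq \<theta> \<and> 0 \<le> height3_sq \<theta>}"
  proof (intro subset_antisym subsetI)
    fix \<theta> assume "\<theta> \<in> {\<theta> \<in> {0<..<2 * pi}. 0 \<le> height2_sq \<theta> \<and> 0 \<le> height3_sq \<theta>}"
    then have "(\<theta>, sqrt (height2_sq \<theta>), sqrt (height3_sq \<theta>)) \<in> model"
      by (simp add: model_def sheets_def)
    then show "\<theta> \<in> fst ` model" by force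
  next
    fix \<theta> assume "\<theta> \<in> fst ` model"
    then obtain Y Z where "\<theta> \<in> {0<..<2 * pi}" "Y\<^sup>2 = height2_sq \<theta>" "Z\<^sup>2 = height3_sq \<theta>"
      by (auto simp: model_def sheets_def)
    then show "\<theta> \<in> {\<theta> \<in> {0<..<2 * pi}. 0 \<le> height2_sq \<theta> \<and> 0 \<le> height3_sq \<theta>}"
      by (metis (mono_tags, lifting) mem_Collect_eq zero_le_power2)
  qed
  finally show ?thesis .
qed

lemma card_theta1_fibre:
  "card {m \<in> topspace (moduli_space L). theta1 m = \<theta>} = card {p \<in> model. fst p = \<theta>}"
proof (rule bij_betw_same_card)
  have "moduli_coords ` {m \<in> topspace (moduli_space L). theta1 m = \<theta>} = {p \<in> model. fst p = \<theta>}"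
  proof (intro subset_antisym subsetI)
    fix p assume p: "p \<in> {p \<in> model. fst p = \<theta>}"
    then obtain m where "m \<in> topspace (moduli_space L)" "p = moduli_coords m"
      using bij_betw_imp_surj_on[OF bij_betw_moduli_coords] by (metis (no_types, lifting) imageE mem_Collect_eq)
    then show "p \<in> moduli_coords ` {m \<in> topspace (moduli_space L). theta1 m = \<theta>}"
      using p theta1_moduli_coords by simp
  qed (use bij_betwE[OF bij_betw_moduli_coords] theta1_moduli_coords in fastforce)
  then show "bij_betw moduli_coords {m \<in> topspace (moduli_space L). theta1 m = \<theta>} {p \<in> model. fst p = \<theta>}"
    by (intro bij_betw_subset[OF bij_betw_moduli_coords]) simp_all
qed

text \<open>
  All legs span the same distance, and this distance is a function of the angle of the first leg.
\<close>

lemma legs: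
  assumes "u \<in> config_space L"
  shows "straight (leg 2 u) \<and> angle (leg 2 u) = 0 \<longleftrightarrow> base_sq a b (angle (leg 1 u)) = (c - d)\<^sup>2"
    and "straight (leg 2 u) \<and> angle (leg 2 u) = pi \<longleftrightarrow> base_sq a b (angle (leg 1 u)) = (c + d)\<^sup>2"
    and "straight (leg 3 u) \<and> angle (leg 3 u) = 0 \<longleftrightarrow> base_sq a b (angle (leg 1 u)) = (e - f)\<^sup>2"
    and "straight (leg 3 u) \<and> angle (leg 3 u) = pi \<longleftrightarrow> base_sq a b (angle (leg 1 u)) = (e + f)\<^sup>2"
proof -
  obtain x y z w where u: "u = ((0, x, w), (0, y, w), (0, z, w))" and legs:
    "(0, x, w) \<in> free_configs (a, b)" "(0, y, w) \<in> free_configs (c, d)" "(0, z, w) \<in> free_configs (e, f)"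
    using assms by (elim config_cases)
  have "base_sq a b (angle (leg 1 u)) = (cmod w)\<^sup>2"
    using law_of_cosines[OF legs(1)] pos by (simp add: u leg_def)
  then show "straight (leg 2 u) \<and> angle (leg 2 u) = 0 \<longleftrightarrow> base_sq a b (angle (leg 1 u)) = (c - d)\<^sup>2"
    "straight (leg 2 u) \<and> angle (leg 2 u) = pi \<longleftrightarrow> base_sq a b (angle (leg 1 u)) = (c + d)\<^sup>2"
    "straight (leg 3 u) \<and> angle (leg 3 u) = 0 \<longleftrightarrow> base_sq a b (angle (leg 1 u)) = (e - f)\<^sup>2"
    "straight (leg 3 u) \<and> angle (leg 3 u) = pi \<longleftrightarrow> base_sq a b (angle (leg 1 u)) = (e + f)\<^sup>2"
    using folded_or_stretched[OF legs(2)] folded_or_stretched[OF legs(3)] pos by (simp_all add: u leg_def)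
qed

lemma foldable_iff:
  "foldable_at L 2 \<theta> \<longleftrightarrow> \<theta> \<in> theta1 ` topspace (moduli_space L) \<and> base_sq a b \<theta> = (c - d)\<^sup>2"
  "foldable_at L 3 \<theta> \<longleftrightarrow> \<theta> \<in> theta1 ` topspace (moduli_space L) \<and> base_sq a b \<theta> = (e - f)\<^sup>2"
  unfolding foldable_at_def theta1_image_angles image_iff by (simp_all add: legs cong: bex_cong) (metis (lifting))+

lemma collapsible_iff:
  "collapsible L 2 \<longleftrightarrow> (\<exists>\<theta> \<in> theta1 ` topspace (moduli_space L). base_sq a b \<theta> = (c + d)\<^sup>2)"
  "collapsible L 3 \<longleftrightarrow> (\<exists>\<theta> \<in> theta1 ` topspace (moduli_space L). base_sq a b \<theta> = (e + f)\<^sup>2)"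
  unfolding collapsible_def theta1_image_angles by (simp_all add: legs cong: bex_cong)

end

section \<open>Where the legs degenerate\<close>

lemma base_sq_reflect: "base_sq p q (2 * pi - \<theta>) = base_sq p q \<theta>"
  by (simp add: base_sq_def cos_diff)

lemma base_sq_pi: "base_sq p q pi = (p + q)\<^sup>2"
  by (simp add: base_sq_def power2_sum)

lemma base_sq_strict_mono:
  assumes "p > 0" "q > 0" "0 \<le> s" "s < t" "t \<le> pi"
  shows "base_sq p q s < base_sq p q t"
  using mult_strict_left_mono[OF cos_monotone_0_pi[OF assms(3-5)], of "2 * p * q"] assms(1,2)
  by (simp add: base_sq_def)

lemma base_sq_le:
  assumes "p > 0" "q > 0"
  shows "base_sq p q \<theta> \<le> (p + q)\<^sup>2"
proof -
  have "(p * q) * (- 1) \<le> (p * q) * cos \<theta>"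
    using assms by (intro mult_left_mono) auto
  then show ?thesis by (simp add: base_sq_def power2_sum)
qed

lemma continuous_area_sq: "continuous_on A (\<lambda>\<theta>. area_sq p q (base_sq a b \<theta>))"
  unfolding area_sq_def base_sq_def by (intro continuous_intros) auto

text \<open>
  Between \<open>\<alpha>\<close> and \<open>\<pi>\<close> the base grows strictly, from a length at which the triangle exists. It thus
  stays above \<open>\<bar>p - q\<bar>\<close> after the start, and below \<open>a + b \<le> p + q\<close> before \<open>\<pi>\<close>, so in Heron's formula the
  first factor can vanish only at \<open>\<pi>\<close> and the second one only at \<open>\<alpha>\<close>. Reflection at \<open>\<pi>\<close> covers the
  other half of the interval.
\<close>

lemma area_sq_zeros:
  fixes h :: "real \<Rightarrow> real"
  assumes h: "\<And>\<theta>. h \<theta> = area_sq p q (base_sq a b \<theta>)"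
    and pos: "a > 0" "b > 0" and le: "a + b \<le> p + q" and \<alpha>: "0 < \<alpha>" "\<alpha> < pi"
    and nonneg: "0 \<le> h \<alpha>"
  shows "h \<alpha> = 0 \<longleftrightarrow> base_sq a b \<alpha> = (p - q)\<^sup>2"
    and "h pi = 0 \<longleftrightarrow> a + b = p + q"
    and "\<And>\<theta>. \<theta> \<in> {\<alpha>..2 * pi - \<alpha>} \<Longrightarrow> h \<theta> = 0 \<Longrightarrow> \<theta> \<in> {\<alpha>, pi, 2 * pi - \<alpha>}"
proof -
  let ?B = "base_sq a b"
  \<comment> \<open>The first factor is controlled by \<open>a + b \<le> p + q\<close>, the second one by monotonicity of the base.\<close>
  have heron': "4 * h \<theta> = ((p + q)\<^sup>2 - ?B \<theta>) * (?B \<theta> - (p - q)\<^sup>2)" for \<theta>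
    unfolding h by (rule heron)
  have le2: "(a + b)\<^sup>2 \<le> (p + q)\<^sup>2" using pos le by (intro power_mono) auto
  have lt: "?B \<theta> < (p + q)\<^sup>2" if "0 \<le> \<theta>" "\<theta> < pi" for \<theta>
    using base_sq_strict_mono[OF pos that] le2 by (simp add: base_sq_pi)
  have \<alpha>lt: "?B \<alpha> < (p + q)\<^sup>2" using lt \<alpha> by simp
  then show "h \<alpha> = 0 \<longleftrightarrow> ?B \<alpha> = (p - q)\<^sup>2" using heron'[of \<alpha>] by auto
  have ge: "(p - q)\<^sup>2 \<le> ?B \<alpha>"
  proof -
    have "0 \<le> ((p + q)\<^sup>2 - ?B \<alpha>) * (?B \<alpha> - (p - q)\<^sup>2)" using nonneg heron'[of \<alpha>] by simp
    then show ?thesis using \<alpha>lt by (simp add: zero_le_mult_iff)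
  qed
  have gt: "(p - q)\<^sup>2 < ?B \<theta>" if "\<alpha> < \<theta>" "\<theta> \<le> pi" for \<theta>
    using base_sq_strict_mono[OF pos _ that] \<alpha> ge by simp
  have "(p - q)\<^sup>2 < (a + b)\<^sup>2" using gt[of pi] \<alpha> by (simp add: base_sq_pi)
  then have "h pi = 0 \<longleftrightarrow> (p + q)\<^sup>2 = (a + b)\<^sup>2"
    using heron'[of pi] by (auto simp: base_sq_pi)
  also have "\<dots> \<longleftrightarrow> a + b = p + q" using pos le by (auto simp: power2_eq_iff_nonneg)
  finally show "h pi = 0 \<longleftrightarrow> a + b = p + q" .
  have inner: "\<theta> = \<alpha> \<or> \<theta> = pi" if "h \<theta> = 0" "\<alpha> \<le> \<theta>" "\<theta> \<le> pi" for \<theta>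
    using heron'[of \<theta>] lt[of \<theta>] gt[of \<theta>] that \<alpha> by force
  fix \<theta> assume \<theta>: "\<theta> \<in> {\<alpha>..2 * pi - \<alpha>}" "h \<theta> = 0"
  have "h (2 * pi - \<theta>) = 0" using \<theta>(2) by (simp add: h base_sq_reflect)
  then show "\<theta> \<in> {\<alpha>, pi, 2 * pi - \<alpha>}"
    using inner[of \<theta>] inner[of "2 * pi - \<theta>"] \<theta> by force
qed

text \<open>
  The set of possible angles is symmetric about \<open>\<pi>\<close>. If both functions were positive at the left end,
  they would remain positive slightly to the left of it, and the interval would extend further.
\<close>

lemma symmetric_endpoints:
  fixes h k :: "real \<Rightarrow> real"
  assumes S: "{\<theta> \<in> {0<..<2 * pi}. 0 \<le> h \<theta> \<and> 0 \<le> k \<theta>} = {\<alpha>..\<beta>}" and "\<alpha> < \<beta>"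
    and cont: "isCont h \<alpha>" "isCont k \<alpha>"
    and reflect: "\<And>\<theta>. h (2 * pi - \<theta>) = h \<theta>" "\<And>\<theta>. k (2 * pi - \<theta>) = k \<theta>"
  shows "\<beta> = 2 * pi - \<alpha>" and "h \<alpha> = 0 \<or> k \<alpha> = 0"
proof -
  have mem: "\<theta> \<in> {\<alpha>..\<beta>} \<longleftrightarrow> 0 < \<theta> \<and> \<theta> < 2 * pi \<and> 0 \<le> h \<theta> \<and> 0 \<le> k \<theta>" for \<theta>
    unfolding S[symmetric] by auto
  have "2 * pi - \<theta> \<in> {\<alpha>..\<beta>}" if "\<theta> \<in> {\<alpha>..\<beta>}" for \<theta>
    using that unfolding mem reflect by auto
  from this[of \<alpha>] this[of \<beta>] show "\<beta> = 2 * pi - \<alpha>" using \<open>\<alpha> < \<beta>\<close> by auto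
  show "h \<alpha> = 0 \<or> k \<alpha> = 0"
  proof (rule ccontr)
    assume *: "\<not> ?thesis"
    have \<alpha>: "0 < \<alpha>" "\<alpha> < 2 * pi" "0 < h \<alpha>" "0 < k \<alpha>"
      using mem[of \<alpha>] \<open>\<alpha> < \<beta>\<close> * by auto
    have "(h \<longlongrightarrow> h \<alpha>) (at_left \<alpha>)" "(k \<longlongrightarrow> k \<alpha>) (at_left \<alpha>)"
      using cont by (auto simp: isCont_def filterlim_at_split)
    then have "\<forall>\<^sub>F \<theta> in at_left \<alpha>. 0 < h \<theta>" "\<forall>\<^sub>F \<theta> in at_left \<alpha>. 0 < k \<theta>"
      using \<alpha> by (auto intro: order_tendstoD(1))
    moreover have "\<forall>\<^sub>F \<theta> in at_left \<alpha>. \<theta> \<in> {0<..<\<alpha>}"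
      using \<alpha>(1) by (rule eventually_at_left_real)
    ultimately have "\<forall>\<^sub>F \<theta> in at_left \<alpha>. False"
    proof eventually_elim
      case (elim \<theta>)
      then have "\<theta> \<in> {\<alpha>..\<beta>}" unfolding mem using \<alpha>(2) by auto
      then show False using elim by auto
    qed
    then show False by (simp add: eventually_False)
  qed
qed

section \<open>The classification\<close>

theorem theorem4p3:
  fixes a b c d e f \<theta>min \<theta>max :: real
    and L :: linkages
    and v1 v2 v3 v4 :: nat
  assumes L: "L = ((a, b), (c, d), (e, f))"
    and pos: "a > 0" "b > 0" "c > 0" "d > 0" "e > 0" "f > 0"
    and min: "a + b = Min {a + b, c + d, e + f}"
    and generic: "generic L"
    and pi_possible: "pi \<in> theta1 ` topspace (moduli_space L)"
    and zero_impossible: "0 \<notin> theta1 ` topspace (moduli_space L)"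
    and image: "theta1 ` topspace (moduli_space L) = {\<theta>min..\<theta>max}"
    and nondegenerate: "\<theta>min < \<theta>max"
    and inside: "{\<theta>min..\<theta>max} \<subseteq> {0<..<2 * pi}"
    and v1: "v1 = (if collapsible L 2 then 1 else 0)"
    and v2: "v2 = (if foldable_at L 2 \<theta>min \<and> foldable_at L 2 \<theta>max then 1 else 0)"
    and v3: "v3 = (if collapsible L 3 then 1 else 0)"
    and v4: "v4 = (if foldable_at L 3 \<theta>min \<and> foldable_at L 3 \<theta>max then 1 else 0)"
  shows "((1, 1) \<notin> set [(v1, v2), (v3, v4)] \<longrightarrow> formed_by_two (moduli_space L) circle) \<and>
    ((1, 1) \<in> set [(v1, v2), (v3, v4)] \<longrightarrow> formed_by_two (moduli_space L) figure8) \<and>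
    card (connected_components_of (moduli_space L)) = 2 ^ count_list [(v1, v2), (v3, v4)] (0, 0) \<and>
    card {m \<in> topspace (moduli_space L). theta1 m = \<theta>min} = 2 ^ (2 - (v2 + v4)) \<and>
    card {m \<in> topspace (moduli_space L). theta1 m = \<theta>max} = 2 ^ (2 - (v2 + v4)) \<and>
    card {m \<in> topspace (moduli_space L). theta1 m = pi} = 2 ^ (2 - (v1 + v3))"
proof -
  interpret three_legs a b c d e f L
    by unfold_locales (use L pos zero_impossible in \<open>auto simp: theta1_image_angles\<close>)
  let ?h = height2_sq and ?k = height3_sq and ?I = "{\<theta>min..\<theta>max}"
  have le: "a + b \<le> c + d" "a + b \<le> e + f"
    using min Min_le[of "{a + b, c + d, e + f}"] by auto
  have S: "{\<theta> \<in> {0<..<2 * pi}. 0 \<le> ?h \<theta> \<and> 0 \<le> ?k \<theta>} = ?I"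
    using image theta1_image by simp
  have cont: "continuous_on A ?h" "continuous_on A ?k" for A
    unfolding height2_sq_def[abs_def] height3_sq_def[abs_def] by (rule continuous_area_sq)+
  have reflect: "?h (2 * pi - \<theta>) = ?h \<theta>" "?k (2 * pi - \<theta>) = ?k \<theta>" for \<theta>
    by (simp_all add: height2_sq_def height3_sq_def base_sq_reflect)
  have isCont: "isCont ?h \<theta>min" "isCont ?k \<theta>min"
    using cont[of UNIV] by (simp_all add: continuous_on_eq_continuous_at)
  have max: "\<theta>max = 2 * pi - \<theta>min" and min_zero: "?h \<theta>min = 0 \<or> ?k \<theta>min = 0"
    by (rule symmetric_endpoints[where h = ?h and k = ?k, OF S nondegenerate isCont reflect])+
  have nonneg: "0 \<le> ?h \<theta>" "0 \<le> ?k \<theta>" if "\<theta> \<in> ?I" for \<theta>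
    using that unfolding S[symmetric] by simp_all
  have ends: "\<theta>min \<in> ?I" "\<theta>max \<in> ?I" "pi \<in> ?I"
    using nondegenerate max by auto
  have \<theta>min: "0 < \<theta>min" "\<theta>min < pi"
    using subsetD[OF inside ends(1)] nondegenerate max by simp_all
  have mid: "(\<theta>min + \<theta>max) / 2 = pi" by (simp add: max)
  note zeros_2 = area_sq_zeros[where h = ?h, OF height2_sq_def pos(1,2) le(1) \<theta>min nonneg(1)[OF ends(1)]]
    and zeros_3 = area_sq_zeros[where h = ?k, OF height3_sq_def pos(1,2) le(2) \<theta>min nonneg(2)[OF ends(1)]]

  \<comment> \<open>No base is longer than \<open>a + b\<close>, so a leg of total length \<open>s\<close> is stretched only if \<open>s = a + b\<close>.\<close>
  have stretched: "(\<exists>\<theta>\<in>?I. base_sq a b \<theta> = s\<^sup>2) \<longleftrightarrow> a + b = s" if "a + b \<le> s" for s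
  proof
    assume "\<exists>\<theta>\<in>?I. base_sq a b \<theta> = s\<^sup>2"
    then have "s\<^sup>2 \<le> (a + b)\<^sup>2" using base_sq_le[OF pos(1,2)] by metis
    then have "s \<le> a + b" by (rule power2_le_imp_le) (use pos in simp)
    then show "a + b = s" using that by simp
  next
    assume "a + b = s"
    then show "\<exists>\<theta>\<in>?I. base_sq a b \<theta> = s\<^sup>2" using ends(3) base_sq_pi by blast
  qed
  have v: "v1 = (if ?h pi = 0 then 1 else 0)" "v2 = (if ?h \<theta>min = 0 then 1 else 0)"
    "v3 = (if ?k pi = 0 then 1 else 0)" "v4 = (if ?k \<theta>min = 0 then 1 else 0)"
    unfolding v1 v2 v3 v4 collapsible_iff foldable_iff image stretched[OF le(1)] stretched[OF le(2)]
    using zeros_2(1,2) zeros_3(1,2) ends max base_sq_reflect by simp_all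

  \<comment> \<open>A square is nonnegative, so points of the model lie over possible angles only.\<close>
  have model: "model = sheets ?h ?k ?I"
    unfolding S[symmetric] by (auto simp: model_def sheets_def) (metis zero_le_power2)+
  have M: "top_of_set (sheets ?h ?k ?I) homeomorphic_space moduli_space L"
    using moduli_space_homeomorphic_model homeomorphic_maps_imp_homeomorphic_space homeomorphic_space_sym
    unfolding model by blast
  have M': "top_of_set (sheets ?k ?h ?I) homeomorphic_space moduli_space L"
    using M sheets_swap homeomorphic_space_trans by blast
  have zeros_h: "\<theta> \<in> {\<theta>min, pi, \<theta>max}" if "\<theta> \<in> ?I" "?h \<theta> = 0" for \<theta>
    unfolding max by (rule zeros_2(3)) (use that max in simp_all)
  have zeros_k: "\<theta> \<in> {\<theta>min, pi, \<theta>max}" if "\<theta> \<in> ?I" "?k \<theta> = 0" for \<theta>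
    unfolding max by (rule zeros_3(3)) (use that max in simp_all)
  have h_ends: "?h \<theta>max = ?h \<theta>min" "?k \<theta>max = ?k \<theta>min" using reflect by (simp_all add: max)

  \<comment> \<open>The second leg is foldable: the halves are taken with respect to the sign of the third leg.\<close>
  have by_h: "formed_by_two (moduli_space L) (if ?h pi = 0 then figure8 else circle) \<and>
      card (connected_components_of (moduli_space L)) = (if ?k \<theta>min = 0 \<or> ?k pi = 0 then 1 else 2)"
    if zero: "?h \<theta>min = 0"
  proof -
    note pieces = sheets_circle_or_figure8[of \<theta>min \<theta>max ?h ?k, unfolded mid h_ends]
    have "formed_by_two (top_of_set (sheets ?h ?k ?I)) (if ?h pi = 0 then figure8 else circle)"
      by (rule pieces(1)) (assumption | rule nondegenerate cont nonneg zeros_h zeros_k zero)+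
    moreover have "card (connected_components_of (top_of_set (sheets ?h ?k ?I))) =
        (if ?k \<theta>min = 0 \<or> ?k pi = 0 \<or> ?k \<theta>min = 0 then 1 else 2)"
      by (rule pieces(2)) (assumption | rule nondegenerate cont nonneg zeros_h zeros_k zero)+
    ultimately show ?thesis
      using formed_by_two_homeomorphic[OF M] card_components_homeomorphic[OF M] by auto
  qed
  \<comment> \<open>The third leg is foldable: the same with the roles of the two legs exchanged.\<close>
  have by_k: "formed_by_two (moduli_space L) (if ?k pi = 0 then figure8 else circle) \<and>
      card (connected_components_of (moduli_space L)) = (if ?h \<theta>min = 0 \<or> ?h pi = 0 then 1 else 2)"
    if zero: "?k \<theta>min = 0"
  proof -
    note pieces = sheets_circle_or_figure8[of \<theta>min \<theta>max ?k ?h, unfolded mid h_ends]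
    have "formed_by_two (top_of_set (sheets ?k ?h ?I)) (if ?k pi = 0 then figure8 else circle)"
      by (rule pieces(1)) (assumption | rule nondegenerate cont nonneg zeros_h zeros_k zero)+
    moreover have "card (connected_components_of (top_of_set (sheets ?k ?h ?I))) =
        (if ?h \<theta>min = 0 \<or> ?h pi = 0 \<or> ?h \<theta>min = 0 then 1 else 2)"
      by (rule pieces(2)) (assumption | rule nondegenerate cont nonneg zeros_h zeros_k zero)+
    ultimately show ?thesis
      using formed_by_two_homeomorphic[OF M'] card_components_homeomorphic[OF M'] by auto
  qed
  have fibre: "card {m \<in> topspace (moduli_space L). theta1 m = \<theta>} =
      (if ?h \<theta> = 0 then 1 else 2) * (if ?k \<theta> = 0 then 1 else 2)" if "\<theta> \<in> ?I" for \<theta>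
    unfolding card_theta1_fibre model by (rule card_sheets_fibre) (use that nonneg in auto)
  show ?thesis
    unfolding fibre[OF ends(1)] fibre[OF ends(2)] fibre[OF ends(3)] h_ends v
    using min_zero by_h by_k by (auto split: if_splits)
qed

end
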